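(* Let $n\ge 1$, let $\mathfrak g=\mathrm{Der}(\mathbb C[t_1,\dots,t_n])$ and $\mathcal L=\mathrm{Der}(\mathbb C[[t_1,\dots,t_n]])$, so that $\mathfrak g\subset\mathcal L$ is a Lie subalgebra. (a) If $V$ is a simple continuous $\mathcal L$-module, then $V$, with the action restricted to $\mathfrak g$, is a simple smooth $\mathfrak g$-module. (b) If $V$ is a simple smooth $\mathfrak g$-module, then $V$ is naturally a simple continuous $\mathcal L$-module: writing each $D\in\mathcal L$ as $D=\sum_{i=-1}^{\infty}x_i$ with $x_i\in\mathfrak g_i$, the formula $Dv:=\sum_{i\ge -1}x_i v$ for $v\in V$ (a sum with only finitely many nonzero terms) defines an $\mathcal L$-module structure on $V$ for which $V$ is simple and continuous.
   Context: All vector spaces are over $\mathbb C$; $\mathbb Z_+$ denotes the non-negative integers. Write $\partial_i=\partial/\partial t_i$ and $t^\alpha=t_1^{\alpha_1}\cdots t_n^{\alpha_n}$, $|\alpha|=\alpha_1+\dots+\alpha_n$ for $\alpha\in\mathbb Z_+^n$. The Lie algebra $\mathfrak g$ has basis $\{t^\alpha\partial_i\mid \alpha\in\mathbb Z_+^n,\,1\le i\le n\}$ and is $\mathbb Z$-graded by $\mathfrak g=\bigoplus_{k\ge-1}\mathfrak g_k$, $\mathfrak g_k=\mathrm{Span}\{t^\alpha\partial_i\mid |\alpha|=k+1,\ 1\le i\le n\}$. Every $D\in\mathcal L$ has the form $D=\sum_{i=1}^n f_i\partial_i$ with $f_i\in\mathbb C[[t_1,\dots,t_n]]$. For $j\ge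 -1$ set $\mathcal L_j=\{\sum_i f_i\partial_i\mid \deg f_i\ge j+1 \text{ for all } i\}$, where $\deg$ of a power series is the degree of its lowest-degree monomial (with $\deg 0=\infty$). A $\mathfrak g$-module $V$ is smooth if for every $v\in V$ there is $m\in\mathbb Z_+$ with $\mathfrak g_i v=0$ for all $i\ge m$. An $\mathcal L$-module $V$ is continuous if for every $v\in V$ there is a positive integer $k$ with $\mathcal L_k v=0$. *)

theory Defs
  imports Complex_Main "HOL-Library.Poly_Mapping" "HOL-Library.Function_Algebras"
    "HOL-Library.Extended_Nat" "HOL-Library.FuncSet"
begin

section \<open>Polynomials and formal power series in several variables\<close>

text \<open>
  The variables $t_i$ are indexed by a nonempty finite type \<open>'n\<close>, so that $n$ is the cardinality of
  \<open>'n\<close>. Exponents $\alpha$ are elements of \<open>'n \<Rightarrow>\<^sub>0 nat\<close>, polynomials are finitely supported functions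
  on exponents (with the ring structure of \<open>Poly_Mapping\<close>), and power series are arbitrary functions
  on exponents.
\<close>

type_synonym 'n mexp = "'n \<Rightarrow>\<^sub>0 nat"
type_synonym 'n mpol = "'n mexp \<Rightarrow>\<^sub>0 complex"

definition mdeg :: "'n::finite mexp \<Rightarrow> nat"
  where "mdeg \<alpha> = (\<Sum>i\<in>UNIV. Poly_Mapping.lookup \<alpha> i)"

definition unit_exp :: "'n \<Rightarrow> 'n mexp"
  where "unit_exp i = Poly_Mapping.single i 1"

definition monom_pol :: "'n mexp \<Rightarrow> 'n mpol"
  where "monom_pol \<alpha> = Poly_Mapping.single \<alpha> 1"

definition var :: "'n \<Rightarrow> 'n mpol"
  where "var i = monom_pol (unit_exp i)"

definition pol_scale :: "complex \<Rightarrow> 'n mpol \<Rightarrow> 'n mpol"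
  where "pol_scale c p = Poly_Mapping.single 0 c * p"

lift_definition pol_pderiv :: "'n \<Rightarrow> 'n mpol \<Rightarrow> 'n mpol"
  is "\<lambda>i p \<alpha>. of_nat (Poly_Mapping.lookup \<alpha> i + 1) * p (\<alpha> + unit_exp i)"
proof -
  fix i :: 'n and p :: "'n mexp \<Rightarrow> complex"
  assume "finite {\<alpha>. p \<alpha> \<noteq> 0}"
  then have "finite ((\<lambda>\<alpha>. \<alpha> + unit_exp i) -` {\<alpha>. p \<alpha> \<noteq> 0})"
    by (rule finite_vimageI) (simp add: inj_on_def)
  then show "finite {\<alpha>. of_nat (Poly_Mapping.lookup \<alpha> i + 1) * p (\<alpha> + unit_exp i) \<noteq> 0}"
    by (rule rev_finite_subset) auto
qed

typedef 'n mser = "UNIV :: ('n mexp \<Rightarrow> complex) set"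
  morphisms coeff Abs_mser ..

setup_lifting type_definition_mser

lemma mser_eqI: "(\<And>\<alpha>. coeff F \<alpha> = coeff G \<alpha>) \<Longrightarrow> F = G"
  by (metis coeff_inject ext)

definition splits :: "'n mexp \<Rightarrow> ('n mexp \<times> 'n mexp) set"
  where "splits \<alpha> = {(\<beta>, \<gamma>). \<beta> + \<gamma> = \<alpha>}"

lemma finite_le_exp: "finite {\<beta> :: 'n::finite mexp. \<forall>i. Poly_Mapping.lookup \<beta> i \<le> f i}"
proof -
  have "finite (PiE UNIV (\<lambda>i. {..f i}))"
    by (rule finite_PiE) auto
  moreover have "Poly_Mapping.lookup ` {\<beta> :: 'n mexp. \<forall>i. Poly_Mapping.lookup \<beta> i \<le> f i}
      \<subseteq> PiE UNIV (\<lambda>i. {..f i})"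
    by (auto simp: PiE_def Pi_def)
  ultimately have "finite (Poly_Mapping.lookup ` {\<beta> :: 'n mexp. \<forall>i. Poly_Mapping.lookup \<beta> i \<le> f i})"
    by (rule rev_finite_subset)
  then show ?thesis
    by (rule finite_imageD) (auto simp: inj_on_def)
qed

lemma finite_splits [simp]: "finite (splits (\<alpha> :: 'n::finite mexp))"
proof -
  let ?B = "{\<beta> :: 'n mexp. \<forall>i. Poly_Mapping.lookup \<beta> i \<le> Poly_Mapping.lookup \<alpha> i}"
  have "splits \<alpha> \<subseteq> ?B \<times> ?B"
    by (auto simp: splits_def lookup_add)
  then show ?thesis
    by (rule finite_subset) (intro finite_cartesian_product finite_le_exp)
qed

instantiation mser :: (finite) comm_ring_1
begin

lift_definition zero_mser :: "'a mser" is "\<lambda>_. 0" .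
lift_definition one_mser :: "'a mser" is "\<lambda>\<alpha>. if \<alpha> = 0 then 1 else 0" .
lift_definition plus_mser :: "'a mser \<Rightarrow> 'a mser \<Rightarrow> 'a mser" is "\<lambda>F G \<alpha>. F \<alpha> + G \<alpha>" .
lift_definition uminus_mser :: "'a mser \<Rightarrow> 'a mser" is "\<lambda>F \<alpha>. - F \<alpha>" .
lift_definition minus_mser :: "'a mser \<Rightarrow> 'a mser \<Rightarrow> 'a mser" is "\<lambda>F G \<alpha>. F \<alpha> - G \<alpha>" .
lift_definition times_mser :: "'a mser \<Rightarrow> 'a mser \<Rightarrow> 'a mser"
  is "\<lambda>F G \<alpha>. \<Sum>(\<beta>, \<gamma>)\<in>splits \<alpha>. F \<beta> * G \<gamma>" .

instance
proof
  fix F G H :: "'a mser"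
  show "F + G + H = F + (G + H)" by transfer (simp add: add.assoc)
  show "F + G = G + F" by transfer (simp add: add.commute)
  show "0 + F = F" by transfer simp
  show "- F + F = 0" by transfer simp
  show "F - G = F + - G" by transfer simp
  show "(0 :: 'a mser) \<noteq> 1" by transfer (metis zero_neq_one)
  show "(F + G) * H = F * H + G * H"
    by transfer (simp add: fun_eq_iff distrib_right sum.distrib case_prod_unfold)
  show "F * G = G * F"
  proof (transfer, rule ext)
    fix F G :: "'a mexp \<Rightarrow> complex" and \<alpha>
    show "(\<Sum>(\<beta>, \<gamma>)\<in>splits \<alpha>. F \<beta> * G \<gamma>) = (\<Sum>(\<beta>, \<gamma>)\<in>splits \<alpha>. G \<beta> * F \<gamma>)"
      by (rule sum.reindex_bij_witness[of _ prod.swap prod.swap])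
        (auto simp: splits_def add.commute)
  qed
  show "1 * F = F"
  proof (transfer, rule ext)
    fix F :: "'a mexp \<Rightarrow> complex" and \<alpha> :: "'a mexp"
    have "(\<Sum>(\<beta>, \<gamma>)\<in>splits \<alpha>. (if \<beta> = 0 then 1 else 0) * F \<gamma>)
        = (\<Sum>(\<beta>, \<gamma>)\<in>{(0 :: 'a mexp, \<alpha>)}. (if \<beta> = 0 then 1 else 0) * F \<gamma>)"
      by (rule sum.mono_neutral_right, rule finite_splits) (auto simp: splits_def split: if_splits)
    then show "(\<Sum>(\<beta>, \<gamma>)\<in>splits \<alpha>. (if \<beta> = 0 then 1 else 0) * F \<gamma>) = F \<alpha>"
      by simp
  qed
  show "F * G * H = F * (G * H)"
  proof (transfer, rule ext)
    fix F G H :: "'a mexp \<Rightarrow> complex" and \<alpha>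
    have "(\<Sum>(\<beta>, \<gamma>)\<in>splits \<alpha>. (\<Sum>(\<beta>, \<gamma>)\<in>splits \<beta>. F \<beta> * G \<gamma>) * H \<gamma>)
        = (\<Sum>(p, q)\<in>Sigma (splits \<alpha>) (\<lambda>p. splits (fst p)). F (fst q) * G (snd q) * H (snd p))"
      by (subst sum.Sigma[symmetric]) (simp_all add: sum_distrib_right case_prod_unfold)
    also have "\<dots> = (\<Sum>(p, q)\<in>Sigma (splits \<alpha>) (\<lambda>p. splits (snd p)). F (fst p) * (G (fst q) * H (snd q)))"
      by (rule sum.reindex_bij_witness[of _
            "\<lambda>(p, q). ((fst p + fst q, snd q), (fst p, fst q))"
            "\<lambda>(p, q). ((fst q, snd q + snd p), (snd q, snd p))"])
        (auto simp: splits_def add.assoc)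
    also have "\<dots> = (\<Sum>(\<beta>, \<gamma>)\<in>splits \<alpha>. F \<beta> * (\<Sum>(\<beta>, \<gamma>)\<in>splits \<gamma>. G \<beta> * H \<gamma>))"
      by (subst sum.Sigma[symmetric]) (simp_all add: sum_distrib_left case_prod_unfold)
    finally show "(\<Sum>(\<beta>, \<gamma>)\<in>splits \<alpha>. (\<Sum>(\<beta>, \<gamma>)\<in>splits \<beta>. F \<beta> * G \<gamma>) * H \<gamma>)
        = (\<Sum>(\<beta>, \<gamma>)\<in>splits \<alpha>. F \<beta> * (\<Sum>(\<beta>, \<gamma>)\<in>splits \<gamma>. G \<beta> * H \<gamma>))" .
  qed
qed

end

lemma coeff_simps [simp]:
  fixes F G :: "'n::finite mser"
  shows "coeff 0 \<alpha> = 0" "coeff (F + G) \<alpha> = coeff F \<alpha> + coeff G \<alpha>"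
    "coeff (- F) \<alpha> = - coeff F \<alpha>" "coeff (F - G) \<alpha> = coeff F \<alpha> - coeff G \<alpha>"
  by (transfer, simp)+

lemma coeff_mult:
  "coeff (F * G) \<alpha> = (\<Sum>(\<beta>, \<gamma>)\<in>splits \<alpha>. coeff F \<beta> * coeff G \<gamma>)"
  for F G :: "'n::finite mser"
  by transfer simp

lemma coeff_sum: "coeff (sum f A) \<alpha> = (\<Sum>a\<in>A. coeff (f a) \<alpha>)"
  for f :: "'b \<Rightarrow> 'n::finite mser"
  by (induction A rule: infinite_finite_induct) auto

lift_definition ser_scale :: "complex \<Rightarrow> 'n mser \<Rightarrow> 'n mser" is "\<lambda>c F \<alpha>. c * F \<alpha>" .

lift_definition ser_pderiv :: "'n \<Rightarrow> 'n mser \<Rightarrow> 'n mser"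
  is "\<lambda>i F \<alpha>. of_nat (Poly_Mapping.lookup \<alpha> i + 1) * F (\<alpha> + unit_exp i)" .

definition ser_of_pol :: "'n mpol \<Rightarrow> 'n mser"
  where "ser_of_pol p = Abs_mser (Poly_Mapping.lookup p)"

text \<open>The degree of the lowest-degree monomial; the infimum of the empty set gives \<open>\<infinity>\<close> for the zero
  series.\<close>

definition ser_deg :: "'n::finite mser \<Rightarrow> enat"
  where "ser_deg F = (INF \<alpha>\<in>{\<alpha>. coeff F \<alpha> \<noteq> 0}. enat (mdeg \<alpha>))"

lemma ser_deg_zero: "ser_deg 0 = \<infinity>"
  by (simp add: ser_deg_def top_enat_def)

lemma ser_deg_ge_iff: "enat d \<le> ser_deg F \<longleftrightarrow> (\<forall>\<alpha>. coeff F \<alpha> \<noteq> 0 \<longrightarrow> d \<le> mdeg \<alpha>)"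
  by (auto simp: ser_deg_def le_INF_iff)


section \<open>Lie algebras of derivations and their modules\<close>

definition op_scale :: "(complex \<Rightarrow> 'a \<Rightarrow> 'a) \<Rightarrow> complex \<Rightarrow> ('a \<Rightarrow> 'a) \<Rightarrow> 'a \<Rightarrow> 'a"
  where "op_scale s c D = (\<lambda>f. s c (D f))"

definition lie_bracket :: "('a \<Rightarrow> 'a) \<Rightarrow> ('a \<Rightarrow> 'a) \<Rightarrow> 'a \<Rightarrow> 'a::ab_group_add"
  where "lie_bracket D E = (\<lambda>f. D (E f) - E (D f))"

definition Der :: "(complex \<Rightarrow> 'a \<Rightarrow> 'a) \<Rightarrow> ('a \<Rightarrow> 'a::comm_ring_1) set"
  where "Der s = {D. Vector_Spaces.linear s s D \<and> (\<forall>f g. D (f * g) = D f * g + f * D g)}"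

text \<open>A Lie algebra of operators on the vector space \<open>'a\<close>, with the commutator as bracket. The ambient
  addition of operators is pointwise.\<close>

locale operator_lie_algebra = vector_space s
  for s :: "complex \<Rightarrow> 'a::ab_group_add \<Rightarrow> 'a" +
  fixes G :: "('a \<Rightarrow> 'a) set"
  assumes lin_op: "D \<in> G \<Longrightarrow> Vector_Spaces.linear s s D"
    and zero_mem: "0 \<in> G"
    and add_mem: "D \<in> G \<Longrightarrow> E \<in> G \<Longrightarrow> D + E \<in> G"
    and scale_mem: "D \<in> G \<Longrightarrow> op_scale s c D \<in> G"
    and bracket_mem: "D \<in> G \<Longrightarrow> E \<in> G \<Longrightarrow> lie_bracket D E \<in> G"

text \<open>A module over such a Lie algebra; the action is only relevant on the carrier \<open>G\<close>.\<close>

locale lie_module = operator_lie_algebra s G + V: vector_space sV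
  for s :: "complex \<Rightarrow> 'a::ab_group_add \<Rightarrow> 'a" and G :: "('a \<Rightarrow> 'a) set"
    and sV :: "complex \<Rightarrow> 'v::ab_group_add \<Rightarrow> 'v" +
  fixes act :: "('a \<Rightarrow> 'a) \<Rightarrow> 'v \<Rightarrow> 'v"
  assumes act_linear: "D \<in> G \<Longrightarrow> Vector_Spaces.linear sV sV (act D)"
    and act_add: "D \<in> G \<Longrightarrow> E \<in> G \<Longrightarrow> act (D + E) v = act D v + act E v"
    and act_scale: "D \<in> G \<Longrightarrow> act (op_scale s c D) v = sV c (act D v)"
    and act_bracket:
      "D \<in> G \<Longrightarrow> E \<in> G \<Longrightarrow> act (lie_bracket D E) v = act D (act E v) - act E (act D v)"

locale simple_lie_module = lie_module s G sV act
  for s :: "complex \<Rightarrow> 'a::ab_group_add \<Rightarrow> 'a" and G :: "('a \<Rightarrow> 'a) set"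
    and sV :: "complex \<Rightarrow> 'v::ab_group_add \<Rightarrow> 'v" and act :: "('a \<Rightarrow> 'a) \<Rightarrow> 'v \<Rightarrow> 'v" +
  assumes nonzero: "\<exists>v::'v. v \<noteq> 0"
    and no_proper_submodule:
      "\<And>W. V.subspace W \<Longrightarrow> (\<forall>D\<in>G. \<forall>w\<in>W. act D w \<in> W) \<Longrightarrow> W = {0} \<or> W = UNIV"


section \<open>The Lie algebras of polynomial and of formal vector fields\<close>

definition pol_Der :: "('n::finite mpol \<Rightarrow> 'n mpol) set"
  where "pol_Der = Der pol_scale"

definition ser_Der :: "('n::finite mser \<Rightarrow> 'n mser) set"
  where "ser_Der = Der ser_scale"

text \<open>The embedding of $\mathrm{Der}(\mathbb{C}[t])$ into $\mathrm{Der}(\mathbb{C}[[t]])$ sends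
  $\sum_i f_i \partial_i$ to $\sum_i f_i \partial_i$; here $f_i = D(t_i)$.\<close>

definition der_ext :: "('n::finite mpol \<Rightarrow> 'n mpol) \<Rightarrow> 'n mser \<Rightarrow> 'n mser"
  where "der_ext D = (\<Sum>i\<in>UNIV. (\<lambda>F. ser_of_pol (D (var i)) * ser_pderiv i F))"

definition pol_Der_grade :: "int \<Rightarrow> ('n::finite mpol \<Rightarrow> 'n mpol) set"
  where "pol_Der_grade k = module.span (op_scale pol_scale)
    {(\<lambda>p. monom_pol \<alpha> * pol_pderiv i p) | \<alpha> i. int (mdeg \<alpha>) = k + 1}"

text \<open>Intended for \<open>j \<ge> -1\<close>.\<close>

definition ser_Der_filt :: "int \<Rightarrow> ('n::finite mser \<Rightarrow> 'n mser) set"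
  where "ser_Der_filt j = {(\<Sum>i\<in>UNIV. (\<lambda>F. f i * ser_pderiv i F)) | f.
    \<forall>i. enat (nat (j + 1)) \<le> ser_deg (f i)}"

definition smooth_action :: "(('n::finite mpol \<Rightarrow> 'n mpol) \<Rightarrow> 'v \<Rightarrow> 'v::ab_group_add) \<Rightarrow> bool"
  where "smooth_action act \<longleftrightarrow>
    (\<forall>v. \<exists>m::nat. \<forall>i\<ge>int m. \<forall>D\<in>pol_Der_grade i. act D v = 0)"

definition continuous_action :: "(('n::finite mser \<Rightarrow> 'n mser) \<Rightarrow> 'v \<Rightarrow> 'v::ab_group_add) \<Rightarrow> bool"
  where "continuous_action act \<longleftrightarrow>
    (\<forall>v. \<exists>k::nat. k > 0 \<and> (\<forall>D\<in>ser_Der_filt (int k). act D v = 0))"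

text \<open>\<open>homogeneous_expansion D x\<close> says $D = \sum_{i \ge -1} x_i$ with $x_i \in \mathfrak{g}_i$. The infinite
  sum is the limit of the partial sums for the filtration \<open>ser_Der_filt\<close>, i.e. coefficientwise. For
  \<open>i < -1\<close> the condition \<open>x i \<in> pol_Der_grade i\<close> forces \<open>x i = 0\<close>.\<close>

definition homogeneous_expansion ::
    "('n::finite mser \<Rightarrow> 'n mser) \<Rightarrow> (int \<Rightarrow> 'n mpol \<Rightarrow> 'n mpol) \<Rightarrow> bool"
  where "homogeneous_expansion D x \<longleftrightarrow> (\<forall>i. x i \<in> pol_Der_grade i) \<and>
    (\<forall>m::nat. \<exists>K::nat. \<forall>k\<ge>K. D - (\<Sum>i\<in>{-1..int k}. der_ext (x i)) \<in> ser_Der_filt (int m))"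


section \<open>Basic facts\<close>

lemma vector_space_pol_scale: "vector_space pol_scale"
  by unfold_locales
    (simp_all add: pol_scale_def algebra_simps single_add mult_single flip: mult.assoc)

lemma vector_space_ser_scale: "vector_space (ser_scale :: complex \<Rightarrow> 'n::finite mser \<Rightarrow> _)"
  by unfold_locales (transfer, simp add: fun_eq_iff algebra_simps)+

lemma vector_space_op_scale: "vector_space s \<Longrightarrow> vector_space (op_scale s)"
  for s :: "complex \<Rightarrow> 'a::ab_group_add \<Rightarrow> 'a"
  unfolding vector_space_def op_scale_def by (simp add: fun_eq_iff)

lemma pol_scale_mult: "pol_scale c (f * g) = pol_scale c f * g"
  by (simp add: pol_scale_def mult.assoc)

lemma ser_scale_mult: "ser_scale c (F * G) = ser_scale c F * G" for F G :: "'n::finite mser"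
  by transfer (simp add: sum_distrib_left fun_eq_iff case_prod_unfold mult.assoc)

lemma operator_lie_algebra_Der:
  fixes s :: "complex \<Rightarrow> 'a::comm_ring_1 \<Rightarrow> 'a"
  assumes "vector_space s" and sm: "\<And>c f g. s c (f * g) = s c f * g"
  shows "operator_lie_algebra s (Der s)"
proof -
  interpret vector_space s by fact
  have sm': "s c (f * g) = f * s c g" for c f g
    using sm[of c g f] by (simp add: mult.commute)
  have lin: "Vector_Spaces.linear s s D \<longleftrightarrow> (\<forall>x y. D (x + y) = D x + D y) \<and> (\<forall>c x. D (s c x) = s c (D x))" for D
    by (auto simp: Vector_Spaces.linear_def module_hom_def module_hom_axioms_def assms(1) module_axioms)
  have Der: "D \<in> Der s \<longleftrightarrow> (\<forall>x y. D (x + y) = D x + D y) \<and> (\<forall>c x. D (s c x) = s c (D x))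
      \<and> (\<forall>f g. D (f * g) = D f * g + f * D g)" for D
    by (simp add: Der_def lin)
  show ?thesis
  proof (intro operator_lie_algebra.intro operator_lie_algebra_axioms.intro)
    show "vector_space s" by fact
    show "0 \<in> Der s" by (simp add: Der)
  next
    fix D :: "'a \<Rightarrow> 'a" and c
    assume D: "D \<in> Der s"
    show "Vector_Spaces.linear s s D" using D by (simp add: Der_def)
    show "op_scale s c D \<in> Der s"
      using D by (simp add: Der op_scale_def scale_right_distrib sm[symmetric] sm'[symmetric] mult.commute)
  next
    fix D E :: "'a \<Rightarrow> 'a"
    assume D: "D \<in> Der s" and E: "E \<in> Der s"
    show "D + E \<in> Der s"
      using D E by (simp add: Der algebra_simps)
    show "lie_bracket D E \<in> Der s"
      using D E by (simp add: Der lie_bracket_def scale_right_diff_distrib) (simp add: algebra_simps)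
  qed
qed

lemma operator_lie_algebra_pol_Der: "operator_lie_algebra pol_scale (pol_Der :: ('n::finite mpol \<Rightarrow> _) set)"
  unfolding pol_Der_def
  by (rule operator_lie_algebra_Der) (simp_all add: vector_space_pol_scale pol_scale_mult)

lemma operator_lie_algebra_ser_Der: "operator_lie_algebra ser_scale (ser_Der :: ('n::finite mser \<Rightarrow> _) set)"
  unfolding ser_Der_def
  by (rule operator_lie_algebra_Der) (simp_all add: vector_space_ser_scale ser_scale_mult)

lemma coeff_ser_of_pol [simp]: "coeff (ser_of_pol p) \<alpha> = Poly_Mapping.lookup p \<alpha>"
  by (simp add: ser_of_pol_def Abs_mser_inverse)

lemma inj_ser_of_pol: "inj ser_of_pol"
  by (rule injI) (metis coeff_ser_of_pol poly_mapping_eqI)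

lemma ser_of_pol_simps:
  fixes p q :: "'n::finite mpol"
  shows "ser_of_pol 0 = 0" "ser_of_pol (p + q) = ser_of_pol p + ser_of_pol q"
    "ser_of_pol (p - q) = ser_of_pol p - ser_of_pol q"
  by (auto intro!: mser_eqI simp: lookup_add lookup_minus)

lemma ser_of_pol_sum: "ser_of_pol (sum f A) = (\<Sum>a\<in>A. ser_of_pol (f a))"
  for f :: "'b \<Rightarrow> 'n::finite mpol"
  by (induction A rule: infinite_finite_induct) (auto simp: ser_of_pol_simps)

lemma ser_of_pol_mult: "ser_of_pol (p * q) = ser_of_pol p * ser_of_pol q"
  for p q :: "'n::finite mpol"
proof (rule mser_eqI)
  fix \<alpha>
  have "Poly_Mapping.lookup (p * q) \<alpha> =
      (\<Sum>(\<beta>, \<gamma>). Poly_Mapping.lookup p \<beta> * Poly_Mapping.lookup q \<gamma> when \<alpha> = \<beta> + \<gamma>)"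
    by (simp add: times_poly_mapping.rep_eq prod_fun_unfold_prod)
  also have "\<dots> = (\<Sum>(\<beta>, \<gamma>)\<in>splits \<alpha>. Poly_Mapping.lookup p \<beta> * Poly_Mapping.lookup q \<gamma> when \<alpha> = \<beta> + \<gamma>)"
    by (rule Sum_any.expand_superset, rule finite_splits)
      (auto simp: splits_def when_def split: if_splits)
  also have "\<dots> = coeff (ser_of_pol p * ser_of_pol q) \<alpha>"
    unfolding coeff_mult by (rule sum.cong) (auto simp: splits_def)
  finally show "coeff (ser_of_pol (p * q)) \<alpha> = coeff (ser_of_pol p * ser_of_pol q) \<alpha>"
    by simp
qed

lemma coeff_ser_pderiv:
  "coeff (ser_pderiv i F) \<alpha> = of_nat (Poly_Mapping.lookup \<alpha> i + 1) * coeff F (\<alpha> + unit_exp i)"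
  by transfer simp

lemma lookup_pol_pderiv:
  "Poly_Mapping.lookup (pol_pderiv i p) \<alpha>
    = of_nat (Poly_Mapping.lookup \<alpha> i + 1) * Poly_Mapping.lookup p (\<alpha> + unit_exp i)"
  by transfer simp

lemma ser_of_pol_pderiv: "ser_of_pol (pol_pderiv i p) = ser_pderiv i (ser_of_pol p)"
  by (rule mser_eqI) (simp add: coeff_ser_pderiv lookup_pol_pderiv)

lemma lookup_unit_exp: "Poly_Mapping.lookup (unit_exp i) j = (if i = j then 1 else 0)"
  by (simp add: unit_exp_def lookup_single when_def)

lemma ser_pderiv_commute: "ser_pderiv i (ser_pderiv j F) = ser_pderiv j (ser_pderiv i F)"
  by (rule mser_eqI)
    (auto simp: coeff_ser_pderiv lookup_add lookup_unit_exp ac_simps)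

lemma ser_pderiv_add: "ser_pderiv i (F + G) = ser_pderiv i F + ser_pderiv i G" for F G :: "'n::finite mser"
  by (rule mser_eqI) (simp add: coeff_ser_pderiv algebra_simps)

lemma ser_pderiv_sum: "ser_pderiv i (sum f A) = (\<Sum>a\<in>A. ser_pderiv i (f a))"
  for f :: "'b \<Rightarrow> 'n::finite mser"
  by (rule mser_eqI) (simp add: coeff_ser_pderiv coeff_sum sum_distrib_left)

lemma coeff_ser_scale: "coeff (ser_scale c F) \<alpha> = c * coeff F \<alpha>"
  by transfer simp

lemma ser_pderiv_scale: "ser_pderiv i (ser_scale c F) = ser_scale c (ser_pderiv i F)" for F :: "'n::finite mser"
  by (rule mser_eqI) (simp add: coeff_ser_pderiv coeff_ser_scale)

lemma exp_diff_unit: "Poly_Mapping.lookup \<beta> i \<noteq> 0 \<Longrightarrow> \<beta> - unit_exp i + unit_exp i = \<beta>"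
  for \<beta> :: "'n mexp"
  by (rule poly_mapping_eqI) (auto simp: lookup_add lookup_minus lookup_unit_exp)

lemma ser_pderiv_mult_aux:
  fixes F G :: "'n::finite mser"
  shows "coeff (ser_pderiv i F * G) \<alpha> =
    (\<Sum>(\<beta>, \<gamma>)\<in>splits (\<alpha> + unit_exp i). of_nat (Poly_Mapping.lookup \<beta> i) * coeff F \<beta> * coeff G \<gamma>)"
proof -
  have "coeff (ser_pderiv i F * G) \<alpha> =
     (\<Sum>(\<beta>, \<gamma>)\<in>{(\<beta>, \<gamma>). (\<beta>, \<gamma>) \<in> splits (\<alpha> + unit_exp i) \<and> Poly_Mapping.lookup \<beta> i \<noteq> 0}.
        of_nat (Poly_Mapping.lookup \<beta> i) * coeff F \<beta> * coeff G \<gamma>)"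
    unfolding coeff_mult
  proof (rule sum.reindex_bij_witness[of _ "\<lambda>(\<beta>, \<gamma>). (\<beta> - unit_exp i, \<gamma>)" "\<lambda>(\<beta>, \<gamma>). (\<beta> + unit_exp i, \<gamma>)"], goal_cases)
    case (4 b)
    then obtain \<beta> \<gamma> where b: "b = (\<beta>, \<gamma>)" "\<beta> + \<gamma> = \<alpha> + unit_exp i" "Poly_Mapping.lookup \<beta> i \<noteq> 0"
      by (auto simp: splits_def)
    have "(\<beta> - unit_exp i + \<gamma>) + unit_exp i = \<alpha> + unit_exp i"
      using exp_diff_unit[OF b(3)] b(2) by (metis add.assoc add.commute)
    then show ?case by (simp add: b splits_def)
  next
    case (5 a)
    then show ?case
      by (cases a) (simp add: coeff_ser_pderiv lookup_add lookup_unit_exp)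
  next
    case (3 b)
    then show ?case by (auto simp: exp_diff_unit)
  qed (auto simp: splits_def lookup_add lookup_unit_exp ac_simps)
  also have "\<dots> = (\<Sum>(\<beta>, \<gamma>)\<in>splits (\<alpha> + unit_exp i). of_nat (Poly_Mapping.lookup \<beta> i) * coeff F \<beta> * coeff G \<gamma>)"
    by (rule sum.mono_neutral_left) auto
  finally show ?thesis .
qed

lemma ser_pderiv_mult: "ser_pderiv i (F * G) = ser_pderiv i F * G + F * ser_pderiv i G"
  for F G :: "'n::finite mser"
proof (rule mser_eqI)
  fix \<alpha>
  have "coeff (F * ser_pderiv i G) \<alpha> = coeff (ser_pderiv i G * F) \<alpha>"
    by (simp add: mult.commute)
  also have "\<dots> = (\<Sum>(\<beta>, \<gamma>)\<in>splits (\<alpha> + unit_exp i). of_nat (Poly_Mapping.lookup \<gamma> i) * coeff F \<beta> * coeff G \<gamma>)"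
    unfolding ser_pderiv_mult_aux
    by (rule sum.reindex_bij_witness[of _ prod.swap prod.swap])
      (auto simp: splits_def ac_simps)
  finally have "coeff (ser_pderiv i F * G + F * ser_pderiv i G) \<alpha> =
      (\<Sum>(\<beta>, \<gamma>)\<in>splits (\<alpha> + unit_exp i). of_nat (Poly_Mapping.lookup \<beta> i) * coeff F \<beta> * coeff G \<gamma>) +
      (\<Sum>(\<beta>, \<gamma>)\<in>splits (\<alpha> + unit_exp i). of_nat (Poly_Mapping.lookup \<gamma> i) * coeff F \<beta> * coeff G \<gamma>)"
    by (simp only: coeff_simps ser_pderiv_mult_aux)
  also have "\<dots> = (\<Sum>(\<beta>, \<gamma>)\<in>splits (\<alpha> + unit_exp i).
        of_nat (Poly_Mapping.lookup \<beta> i + Poly_Mapping.lookup \<gamma> i) * (coeff F \<beta> * coeff G \<gamma>))"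
    by (subst sum.distrib[symmetric]) (rule sum.cong, auto simp: algebra_simps)
  also have "\<dots> = (\<Sum>(\<beta>, \<gamma>)\<in>splits (\<alpha> + unit_exp i).
        of_nat (Poly_Mapping.lookup \<alpha> i + 1) * (coeff F \<beta> * coeff G \<gamma>))"
  proof (rule sum.cong, simp, clarify)
    fix \<beta> \<gamma> assume "(\<beta>, \<gamma>) \<in> splits (\<alpha> + unit_exp i)"
    then have "Poly_Mapping.lookup (\<beta> + \<gamma>) i = Poly_Mapping.lookup (\<alpha> + unit_exp i) i"
      by (simp add: splits_def)
    then show "of_nat (Poly_Mapping.lookup \<beta> i + Poly_Mapping.lookup \<gamma> i) * (coeff F \<beta> * coeff G \<gamma>)
        = of_nat (Poly_Mapping.lookup \<alpha> i + 1) * (coeff F \<beta> * coeff G \<gamma>)"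
      by (simp add: lookup_add lookup_unit_exp flip: of_nat_add)
  qed
  also have "\<dots> = coeff (ser_pderiv i (F * G)) \<alpha>"
    unfolding coeff_ser_pderiv coeff_mult by (simp add: sum_distrib_left case_prod_unfold)
  finally show "coeff (ser_pderiv i (F * G)) \<alpha> = coeff (ser_pderiv i F * G + F * ser_pderiv i G) \<alpha>"
    by simp
qed

lemma sum_fun_apply: "(\<Sum>a\<in>A. f a) x = (\<Sum>a\<in>A. f a x)" for f :: "'a \<Rightarrow> 'b \<Rightarrow> 'c::comm_monoid_add"
  by (induction A rule: infinite_finite_induct) auto

lemma der_ext_apply: "der_ext D F = (\<Sum>i\<in>UNIV. ser_of_pol (D (var i)) * ser_pderiv i F)"
  by (simp add: der_ext_def sum_fun_apply)

lemma Der_iff: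
  assumes "vector_space s"
  shows "D \<in> Der s \<longleftrightarrow> (\<forall>f g. D (f + g) = D f + D g) \<and> (\<forall>c f. D (s c f) = s c (D f)) \<and>
    (\<forall>f g. D (f * g) = D f * g + f * D g)"
proof -
  interpret vector_space s by fact
  show ?thesis
    by (auto simp: Der_def Vector_Spaces.linear_def module_hom_def module_hom_axioms_def assms module_axioms)
qed

lemma der_ext_add_arg: "der_ext D (F + G) = der_ext D F + der_ext D G"
  by (simp add: der_ext_apply ser_pderiv_add algebra_simps sum.distrib)

lemma der_ext_sum_arg: "der_ext D (sum f A) = (\<Sum>a\<in>A. der_ext D (f a))"
  by (simp add: der_ext_apply ser_pderiv_sum sum_distrib_left) (rule sum.swap)

lemma der_ext_mult_arg: "der_ext D (F * G) = der_ext D F * G + F * der_ext D G"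
  by (simp add: der_ext_apply ser_pderiv_mult algebra_simps sum.distrib sum_distrib_left)

lemma der_ext_in_ser_Der: "der_ext D \<in> ser_Der"
proof -
  interpret vector_space "ser_scale :: complex \<Rightarrow> 'a mser \<Rightarrow> _" by (rule vector_space_ser_scale)
  have "a * ser_scale c b = ser_scale c (a * b)" for a b :: "'a mser" and c
    using ser_scale_mult[of c b a] by (simp add: mult.commute)
  then have "der_ext D (ser_scale c F) = ser_scale c (der_ext D F)" for c F
    by (simp add: der_ext_apply ser_pderiv_scale scale_sum_right)
  then show ?thesis
    unfolding ser_Der_def Der_iff[OF vector_space_ser_scale]
    using der_ext_add_arg der_ext_mult_arg by blast
qed

lemma ser_of_pol_scale: "ser_of_pol (pol_scale c p) = ser_scale c (ser_of_pol p)" for p :: "'n::finite mpol"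
proof (rule mser_eqI)
  fix \<alpha>
  have "pol_scale c p = Poly_Mapping.map ((*) c) p"
    by (simp add: pol_scale_def mult_map_scale_conv_mult)
  then show "coeff (ser_of_pol (pol_scale c p)) \<alpha> = coeff (ser_scale c (ser_of_pol p)) \<alpha>"
    by (simp add: coeff_ser_scale map.rep_eq when_def)
qed

lemma der_ext_ser_of_pol:
  fixes D :: "'n::finite mpol \<Rightarrow> 'n mpol"
  assumes D: "D \<in> pol_Der"
  shows "der_ext D (ser_of_pol p) = ser_of_pol (D p)"
proof -
  have add: "D (p + q) = D p + D q" and scale: "D (pol_scale c p) = pol_scale c (D p)"
    and mult: "D (p * q) = D p * q + p * D q" for p q c
    using D unfolding pol_Der_def Der_iff[OF vector_space_pol_scale] by blast+
  have E: "der_ext D (ser_scale c F) = ser_scale c (der_ext D F)" for c F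
    using der_ext_in_ser_Der[of D] unfolding ser_Der_def Der_iff[OF vector_space_ser_scale] by blast
  have zero: "D 0 = 0" using add[of 0 0] by simp
  have one: "D 1 = 0" using mult[of 1 1] by simp
  have var: "der_ext D (ser_of_pol (var i)) = ser_of_pol (D (var i))" for i
  proof -
    have "ser_pderiv j (ser_of_pol (var i)) = (if i = j then 1 else 0)" for j
      by (rule mser_eqI)
        (auto simp: coeff_ser_pderiv var_def monom_pol_def lookup_single when_def one_mser.rep_eq unit_exp_def
          poly_mapping_eq_iff fun_eq_iff lookup_add split: if_splits)
    then show ?thesis
      by (simp add: der_ext_apply if_distrib[of "\<lambda>x. _ * x"] cong: if_cong)
  qed
  have mon: "der_ext D (ser_of_pol (monom_pol \<alpha>)) = ser_of_pol (D (monom_pol \<alpha>))" for \<alpha>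
  proof (induction "mdeg \<alpha>" arbitrary: \<alpha>)
    case 0
    then have "\<alpha> = 0" by (intro poly_mapping_eqI) (simp add: mdeg_def)
    then have "monom_pol \<alpha> = 1" by (simp add: monom_pol_def)
    moreover have "ser_of_pol (1 :: 'n mpol) = 1"
      by (rule mser_eqI) (simp add: lookup_one when_def one_mser.rep_eq)
    moreover have "der_ext D 1 = 0"
      using der_ext_mult_arg[of D 1 1] by simp
    ultimately show ?case by (simp add: one ser_of_pol_simps)
  next
    case (Suc d)
    then obtain i where i: "Poly_Mapping.lookup \<alpha> i \<noteq> 0"
      by (metis mdeg_def nat.distinct(1) sum.neutral)
    define \<beta> where "\<beta> = \<alpha> - unit_exp i"
    have \<alpha>: "\<alpha> = \<beta> + unit_exp i" using exp_diff_unit[OF i] by (simp add: \<beta>_def)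
    have "mdeg \<alpha> = mdeg \<beta> + 1"
      by (simp add: \<alpha> mdeg_def lookup_add lookup_unit_exp sum.distrib)
    then have "der_ext D (ser_of_pol (monom_pol \<beta>)) = ser_of_pol (D (monom_pol \<beta>))"
      using Suc by simp
    moreover have "monom_pol \<alpha> = monom_pol \<beta> * var i"
      by (simp add: \<alpha> monom_pol_def var_def mult_single)
    ultimately show ?case
      by (simp add: mult ser_of_pol_simps ser_of_pol_mult der_ext_mult_arg var)
  qed
  have single: "der_ext D (ser_of_pol (Poly_Mapping.single \<alpha> c)) = ser_of_pol (D (Poly_Mapping.single \<alpha> c))"
    for \<alpha> c
  proof -
    have "Poly_Mapping.single \<alpha> c = pol_scale c (monom_pol \<alpha>)"
      by (simp add: pol_scale_def monom_pol_def mult_single)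
    then show ?thesis by (simp add: scale ser_of_pol_scale E mon)
  qed
  have D_sum: "D (sum f A) = (\<Sum>a\<in>A. D (f a))" for f :: "'n mexp \<Rightarrow> 'n mpol" and A
    by (induction A rule: infinite_finite_induct) (simp_all add: zero add)
  have p: "p = (\<Sum>\<alpha>\<in>Poly_Mapping.keys p. Poly_Mapping.single \<alpha> (Poly_Mapping.lookup p \<alpha>))"
    by (rule poly_mapping_eqI)
      (simp add: lookup_sum lookup_single when_def not_in_keys_iff_lookup_eq_zero)
  have "der_ext D (ser_of_pol (\<Sum>\<alpha>\<in>Poly_Mapping.keys p. Poly_Mapping.single \<alpha> (Poly_Mapping.lookup p \<alpha>)))
     = ser_of_pol (D (\<Sum>\<alpha>\<in>Poly_Mapping.keys p. Poly_Mapping.single \<alpha> (Poly_Mapping.lookup p \<alpha>)))"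
    by (simp add: ser_of_pol_sum der_ext_sum_arg D_sum single)
  then show ?thesis
    by (simp flip: p)
qed

lemma inj_on_der_ext: "inj_on der_ext pol_Der"
  by (rule inj_onI, rule ext) (metis der_ext_ser_of_pol inj_ser_of_pol injD)

lemma der_ext_add: "der_ext (D + E) = der_ext D + der_ext E"
  by (simp add: fun_eq_iff der_ext_apply ser_of_pol_simps algebra_simps sum.distrib)

lemma der_ext_scale: "der_ext (op_scale pol_scale c D) = op_scale ser_scale c (der_ext D)"
proof -
  interpret vector_space "ser_scale :: complex \<Rightarrow> 'a mser \<Rightarrow> _" by (rule vector_space_ser_scale)
  show ?thesis
    by (simp add: fun_eq_iff der_ext_apply op_scale_def ser_of_pol_scale scale_sum_right ser_scale_mult)
qed

lemma der_ext_bracket: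
  fixes D E :: "'n::finite mpol \<Rightarrow> 'n mpol"
  assumes "D \<in> pol_Der" "E \<in> pol_Der"
  shows "der_ext (lie_bracket D E) = lie_bracket (der_ext D) (der_ext E)"
proof
  fix F :: "'n mser"
  have *: "der_ext D (der_ext E F) = (\<Sum>j\<in>UNIV. ser_of_pol (D (E (var j))) * ser_pderiv j F) +
    (\<Sum>j\<in>UNIV. \<Sum>i\<in>UNIV. ser_of_pol (E (var j)) * (ser_of_pol (D (var i)) * ser_pderiv i (ser_pderiv j F)))"
    if "D \<in> pol_Der" for D E :: "'n mpol \<Rightarrow> 'n mpol"
  proof -
    have "der_ext D (der_ext E F) = (\<Sum>j\<in>UNIV. der_ext D (ser_of_pol (E (var j)) * ser_pderiv j F))"
      unfolding der_ext_apply[of E] by (rule der_ext_sum_arg)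
    also have "\<dots> = (\<Sum>j\<in>UNIV. ser_of_pol (D (E (var j))) * ser_pderiv j F
        + ser_of_pol (E (var j)) * der_ext D (ser_pderiv j F))"
      by (simp add: der_ext_mult_arg der_ext_ser_of_pol[OF that])
    finally show ?thesis
      by (simp add: der_ext_apply[of D "ser_pderiv _ F"] sum.distrib sum_distrib_left)
  qed
  have "(\<Sum>j\<in>UNIV. \<Sum>i\<in>UNIV. ser_of_pol (E (var j)) * (ser_of_pol (D (var i)) * ser_pderiv i (ser_pderiv j F)))
    = (\<Sum>j\<in>UNIV. \<Sum>i\<in>UNIV. ser_of_pol (D (var j)) * (ser_of_pol (E (var i)) * ser_pderiv i (ser_pderiv j F)))"
    by (subst sum.swap) (simp add: mult.left_commute ser_pderiv_commute)
  then show "der_ext (lie_bracket D E) F = lie_bracket (der_ext D) (der_ext E) F"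
    using *[OF assms(1), of E] *[OF assms(2), of D]
    by (simp add: lie_bracket_def der_ext_apply[of "\<lambda>f. D (E f) - E (D f)"] ser_of_pol_simps algebra_simps
        sum_subtractf)
qed

end

theory Submission
  imports Defs
begin

text \<open>
  The degree-by-degree topology is the whole content: polynomial vector fields are dense among formal
  ones, and both continuity and smoothness say that a given vector is killed by all fields of high
  enough order, so that the action on that vector is locally constant. On one vector, or on finitely many at
  once, a formal vector field therefore acts as any sufficiently fine polynomial truncation.

  Density needs that every derivation \<open>D\<close> of the power series ring is \<open>\<Sum>\<^sub>i D(t\<^sub>i) \<partial>\<^sub>i\<close>, although
  continuity is not part of the definition of a derivation; this is automatic continuity
  (\<open>derivation_eq_0\<close>, \<open>ser_Der_eq_field\<close>). The filtration, the grading and convergence of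
  expansions then become conditions on the coefficients of the \<open>D(t\<^sub>i)\<close> (\<open>ser_Der_filt_iff\<close>,
  \<open>pol_Der_grade_iff\<close>), and the homogeneous expansion of \<open>D\<close> consists of the homogeneous parts of
  the \<open>D(t\<^sub>i)\<close> (\<open>homogeneous_expansion_iff\<close>).

  Restricting a simple continuous module, a subspace stable under polynomial fields is stable under
  formal ones, because these act on each vector through truncations (\<open>simple_smooth_restrict\<close>).

  Conversely, on a smooth module the extended action of \<open>D\<close> on \<open>v\<close> agrees with that of every
  polynomial field close enough to \<open>D\<close> (\<open>completion_eq_act\<close>). Each module identity for formal
  fields thus follows from the one for truncations. For the bracket, the filtration satisfies
  \<open>[\<L>\<^sub>j, \<L>\<^sub>k] \<subseteq> \<L>\<^bsub>j+k\<^esub>\<close> for \<open>j, k \<ge> -1\<close>, so that bracketing costs at most one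
  degree of precision. Simplicity passes up, since a subspace stable under formal fields is in
  particular stable under polynomial ones.
\<close>


section \<open>Orders of power series\<close>

text \<open>Lower bounds on the order are taken in the integers, since applying a vector field of
  level \<open>-1\<close> lowers the order by one.\<close>

definition ord_ge :: "int \<Rightarrow> 'n::finite mser \<Rightarrow> bool"
  where "ord_ge d F \<longleftrightarrow> (\<forall>\<alpha>. coeff F \<alpha> \<noteq> 0 \<longrightarrow> d \<le> int (mdeg \<alpha>))"

lemma ord_geD: "ord_ge d F \<Longrightarrow> int (mdeg \<alpha>) < d \<Longrightarrow> coeff F \<alpha> = 0"
  unfolding ord_ge_def by force

lemma ord_ge_0: "ord_ge d 0"
  by (simp add: ord_ge_def)

lemma ord_ge_add: "ord_ge d F \<Longrightarrow> ord_ge d G \<Longrightarrow> ord_ge d (F + G)"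
  unfolding ord_ge_def coeff_simps by (metis add_0)

lemma ord_ge_diff: "ord_ge d F \<Longrightarrow> ord_ge d G \<Longrightarrow> ord_ge d (F - G)"
  unfolding ord_ge_def coeff_simps by (metis diff_self)

lemma ord_ge_sum: "(\<And>a. a \<in> A \<Longrightarrow> ord_ge d (f a)) \<Longrightarrow> ord_ge d (sum f A)"
  by (induction A rule: infinite_finite_induct) (auto simp: ord_ge_0 ord_ge_add)

lemma mdeg_add: "mdeg (\<alpha> + \<beta>) = mdeg \<alpha> + mdeg \<beta>"
  by (simp add: mdeg_def lookup_add sum.distrib)

lemma mdeg_unit_exp: "mdeg (unit_exp i) = 1"
  by (simp add: mdeg_def lookup_unit_exp)

lemma lookup_le_mdeg: "Poly_Mapping.lookup \<alpha> i \<le> mdeg \<alpha>"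
  unfolding mdeg_def by (rule member_le_sum) auto

lemma ord_ge_mult:
  assumes "ord_ge a F" "ord_ge b G"
  shows "ord_ge (a + b) (F * G)"
  unfolding ord_ge_def
proof (intro allI impI)
  fix \<alpha>
  assume "coeff (F * G) \<alpha> \<noteq> 0"
  then obtain p where "p \<in> splits \<alpha>" "(case p of (\<beta>, \<gamma>) \<Rightarrow> coeff F \<beta> * coeff G \<gamma>) \<noteq> 0"
    unfolding coeff_mult by (rule sum.not_neutral_contains_not_neutral)
  then obtain \<beta> \<gamma> where "\<alpha> = \<beta> + \<gamma>" "coeff F \<beta> \<noteq> 0" "coeff G \<gamma> \<noteq> 0"
    by (cases p) (auto simp: splits_def)
  moreover from this have "a \<le> int (mdeg \<beta>)" "b \<le> int (mdeg \<gamma>)"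
    using assms unfolding ord_ge_def by blast+
  ultimately show "a + b \<le> int (mdeg \<alpha>)"
    by (simp add: mdeg_add)
qed

lemma ord_ge_pderiv:
  assumes "ord_ge d F"
  shows "ord_ge (d - 1) (ser_pderiv i F)"
  unfolding ord_ge_def
proof (intro allI impI)
  fix \<alpha>
  assume "coeff (ser_pderiv i F) \<alpha> \<noteq> 0"
  then have "coeff F (\<alpha> + unit_exp i) \<noteq> 0"
    by (auto simp: coeff_ser_pderiv)
  then have "d \<le> int (mdeg (\<alpha> + unit_exp i))"
    using assms by (simp add: ord_ge_def)
  then show "d - 1 \<le> int (mdeg \<alpha>)"
    by (simp add: mdeg_add mdeg_unit_exp)
qed


section \<open>Derivations are vector fields\<close>

abbreviation ser_var :: "'n \<Rightarrow> 'n::finite mser"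
  where "ser_var i \<equiv> ser_of_pol (var i)"

definition ser_field :: "('n \<Rightarrow> 'n mser) \<Rightarrow> 'n mser \<Rightarrow> 'n::finite mser"
  where "ser_field f = (\<lambda>F. \<Sum>i\<in>UNIV. f i * ser_pderiv i F)"

definition pol_field :: "('n \<Rightarrow> 'n mpol) \<Rightarrow> 'n mpol \<Rightarrow> 'n::finite mpol"
  where "pol_field f = (\<lambda>p. \<Sum>i\<in>UNIV. f i * pol_pderiv i p)"

lemma ser_Der_iff: "D \<in> ser_Der \<longleftrightarrow> (\<forall>f g. D (f + g) = D f + D g) \<and>
    (\<forall>c f. D (ser_scale c f) = ser_scale c (D f)) \<and> (\<forall>f g. D (f * g) = D f * g + f * D g)"
  unfolding ser_Der_def by (rule Der_iff[OF vector_space_ser_scale])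

lemma pol_Der_iff: "D \<in> pol_Der \<longleftrightarrow> (\<forall>f g. D (f + g) = D f + D g) \<and>
    (\<forall>c f. D (pol_scale c f) = pol_scale c (D f)) \<and> (\<forall>f g. D (f * g) = D f * g + f * D g)"
  unfolding pol_Der_def by (rule Der_iff[OF vector_space_pol_scale])

lemma (in operator_lie_algebra) diff_mem:
  assumes "D \<in> G" "E \<in> G"
  shows "D - E \<in> G"
proof -
  have "D - E = D + op_scale s (- 1) E"
    by (simp add: fun_eq_iff op_scale_def)
  then show ?thesis
    by (simp only:) (intro add_mem scale_mem assms)
qed

lemma (in operator_lie_algebra) sum_mem: "(\<And>a. a \<in> A \<Longrightarrow> f a \<in> G) \<Longrightarrow> sum f A \<in> G"
  by (induction A rule: infinite_finite_induct) (auto simp: zero_mem add_mem)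

lemmas ser_Der_closed = operator_lie_algebra.zero_mem[OF operator_lie_algebra_ser_Der]
  operator_lie_algebra.add_mem[OF operator_lie_algebra_ser_Der]
  operator_lie_algebra.scale_mem[OF operator_lie_algebra_ser_Der]
  operator_lie_algebra.bracket_mem[OF operator_lie_algebra_ser_Der]
  operator_lie_algebra.diff_mem[OF operator_lie_algebra_ser_Der]
  operator_lie_algebra.sum_mem[OF operator_lie_algebra_ser_Der]

lemmas pol_Der_closed = operator_lie_algebra.zero_mem[OF operator_lie_algebra_pol_Der]
  operator_lie_algebra.add_mem[OF operator_lie_algebra_pol_Der]
  operator_lie_algebra.scale_mem[OF operator_lie_algebra_pol_Der]
  operator_lie_algebra.bracket_mem[OF operator_lie_algebra_pol_Der]
  operator_lie_algebra.diff_mem[OF operator_lie_algebra_pol_Der]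
  operator_lie_algebra.sum_mem[OF operator_lie_algebra_pol_Der]

lemma ser_field_in_ser_Der: "ser_field f \<in> ser_Der"
proof -
  interpret vector_space "ser_scale :: complex \<Rightarrow> 'a mser \<Rightarrow> _" by (rule vector_space_ser_scale)
  have "a * ser_scale c b = ser_scale c (a * b)" for a b :: "'a mser" and c
    using ser_scale_mult[of c b a] by (simp add: mult.commute)
  then show ?thesis
    by (simp add: ser_Der_iff ser_field_def ser_pderiv_add ser_pderiv_mult ser_pderiv_scale
        scale_sum_right sum.distrib sum_distrib_left sum_distrib_right algebra_simps)
qed

lemma ser_pderiv_var: "ser_pderiv i (ser_var j) = (if i = j then 1 else 0)"
  by (rule mser_eqI)
    (auto simp: coeff_ser_pderiv var_def monom_pol_def lookup_single when_def one_mser.rep_eq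
      unit_exp_def poly_mapping_eq_iff fun_eq_iff lookup_add split: if_splits)

lemma ser_field_var: "ser_field f (ser_var i) = f i"
  by (simp add: ser_field_def ser_pderiv_var if_distrib[of "\<lambda>x. _ * x"] cong: if_cong)

lemma ser_of_pol_field: "ser_of_pol (pol_field f p) = ser_field (\<lambda>i. ser_of_pol (f i)) (ser_of_pol p)"
  by (simp add: pol_field_def ser_field_def ser_of_pol_sum ser_of_pol_mult ser_of_pol_pderiv)

lemma ser_of_pol_eq_iff: "ser_of_pol p = ser_of_pol q \<longleftrightarrow> p = q"
  by (rule inj_eq[OF inj_ser_of_pol])

lemma pol_field_in_pol_Der: "pol_field f \<in> pol_Der"
proof -
  have "ser_field (\<lambda>i. ser_of_pol (f i)) \<in> ser_Der"
    by (rule ser_field_in_ser_Der)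
  then show ?thesis
    unfolding pol_Der_iff ser_Der_iff ser_of_pol_eq_iff[symmetric]
    by (simp add: ser_of_pol_field ser_of_pol_simps ser_of_pol_mult ser_of_pol_scale)
qed

lemma pol_field_var: "pol_field f (var i) = f i"
  by (simp add: ser_of_pol_field ser_field_var flip: ser_of_pol_eq_iff)

lemma lookup_var: "Poly_Mapping.lookup (var i) \<beta> = (if \<beta> = unit_exp i then 1 else 0)"
  by (auto simp: var_def monom_pol_def lookup_single when_def)

lemma coeff_var_mult:
  "coeff (ser_var i * G) \<alpha> =
    (if Poly_Mapping.lookup \<alpha> i = 0 then 0 else coeff G (\<alpha> - unit_exp i))"
proof (cases "Poly_Mapping.lookup \<alpha> i = 0")
  case True
  then have "\<alpha> \<noteq> unit_exp i + \<gamma>" for \<gamma>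
    by (auto simp: lookup_add lookup_unit_exp)
  then have "coeff (ser_var i * G) \<alpha> = 0"
    unfolding coeff_mult by (intro sum.neutral) (auto simp: lookup_var splits_def)
  then show ?thesis using True by simp
next
  case False
  have "coeff (ser_var i * G) \<alpha> =
      (\<Sum>(\<beta>, \<gamma>)\<in>{(unit_exp i, \<alpha> - unit_exp i)}. coeff (ser_var i) \<beta> * coeff G \<gamma>)"
    unfolding coeff_mult
    by (rule sum.mono_neutral_right, rule finite_splits)
      (use exp_diff_unit[OF False] in \<open>auto simp: lookup_var splits_def add.commute split: if_splits\<close>)
  then show ?thesis using False by (simp add: lookup_var)
qed

text \<open>Choosing one variable out of every nonconstant monomial writes a power series without
  constant term as a member of the ideal generated by the variables.\<close>

lemma ser_split_vars:
  fixes F :: "'n::finite mser"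
  obtains c G where "F = ser_scale c 1 + (\<Sum>i\<in>UNIV. ser_var i * G i)"
proof -
  define pick where "pick \<alpha> = (SOME i. Poly_Mapping.lookup \<alpha> i \<noteq> 0)" for \<alpha> :: "'n mexp"
  have pick: "Poly_Mapping.lookup \<alpha> (pick \<alpha>) \<noteq> 0" if "\<alpha> \<noteq> 0" for \<alpha>
  proof -
    have "\<exists>i. Poly_Mapping.lookup \<alpha> i \<noteq> 0"
      using that by (metis lookup_zero poly_mapping_eqI)
    then show ?thesis unfolding pick_def by (rule someI_ex)
  qed
  define G where "G i = Abs_mser (\<lambda>\<beta>. if i = pick (\<beta> + unit_exp i) then coeff F (\<beta> + unit_exp i) else 0)"
    for i
  have G: "coeff (G i) \<beta> = (if i = pick (\<beta> + unit_exp i) then coeff F (\<beta> + unit_exp i) else 0)" for i \<beta>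
    by (simp add: G_def Abs_mser_inverse)
  have "F = ser_scale (coeff F 0) 1 + (\<Sum>i\<in>UNIV. ser_var i * G i)"
  proof (rule mser_eqI)
    fix \<alpha>
    have "coeff (ser_var i * G i) \<alpha> = (if i = pick \<alpha> \<and> \<alpha> \<noteq> 0 then coeff F \<alpha> else 0)" for i
      using exp_diff_unit[of \<alpha> i] pick[of \<alpha>] by (auto simp: coeff_var_mult G)
    then show "coeff F \<alpha> = coeff (ser_scale (coeff F 0) 1 + (\<Sum>i\<in>UNIV. ser_var i * G i)) \<alpha>"
      by (cases "\<alpha> = 0") (auto simp: coeff_sum coeff_ser_scale one_mser.rep_eq)
  qed
  then show thesis by (rule that)
qed

text \<open>Derivations are not assumed continuous, but they are so automatically. If \<open>D\<close> kills the
  variables then, by the preceding decomposition, every value of \<open>D\<close> lies in the ideal generated by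
  the variables times the values of \<open>D\<close>; iterating, every value has infinite order.\<close>

lemma derivation_eq_0:
  assumes D: "D \<in> ser_Der" and var: "\<And>i. D (ser_var i) = 0"
  shows "D F = 0"
proof -
  have add: "D (F + G) = D F + D G" and scale: "D (ser_scale c F) = ser_scale c (D F)"
    and mult: "D (F * G) = D F * G + F * D G" for F G c
    using D unfolding ser_Der_iff by blast+
  have zero: "D 0 = 0" using add[of 0 0] by simp
  have one: "D 1 = 0" using mult[of 1 1] by simp
  have sum: "D (sum f A) = (\<Sum>a\<in>A. D (f a))" for f :: "'a \<Rightarrow> _" and A
    by (induction A rule: infinite_finite_induct) (simp_all add: zero add)
  have ord: "ord_ge (int N) (D F)" for N F
  proof (induction N arbitrary: F)
    case 0
    show ?case by (simp add: ord_ge_def)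
  next
    case (Suc N)
    obtain c G where F: "F = ser_scale c 1 + (\<Sum>i\<in>UNIV. ser_var i * G i)"
      by (rule ser_split_vars)
    have "ser_scale c 0 = 0" by (rule mser_eqI) (simp add: coeff_ser_scale)
    then have "D F = (\<Sum>i\<in>UNIV. ser_var i * D (G i))"
      by (simp add: F add scale one sum mult var)
    moreover have "ord_ge 1 (ser_var i)" for i
      by (auto simp: ord_ge_def lookup_var mdeg_unit_exp)
    ultimately show ?case
      using ord_ge_mult[OF _ Suc.IH] by (auto intro!: ord_ge_sum)
  qed
  show ?thesis
  proof (rule mser_eqI)
    fix \<alpha>
    show "coeff (D F) \<alpha> = coeff 0 \<alpha>"
      using ord[of "Suc (mdeg \<alpha>)" F] by (auto intro: ord_geD)
  qed
qed

lemma ser_Der_eqI: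
  assumes "D \<in> ser_Der" "E \<in> ser_Der" "\<And>i. D (ser_var i) = E (ser_var i)"
  shows "D = E"
proof
  fix F
  have "(D - E) F = 0"
    by (rule derivation_eq_0[of "D - E"]) (simp_all add: assms ser_Der_closed)
  then show "D F = E F" by simp
qed

lemma ser_Der_eq_field: "D \<in> ser_Der \<Longrightarrow> D = ser_field (\<lambda>i. D (ser_var i))"
  by (rule ser_Der_eqI) (auto simp: ser_field_in_ser_Der ser_field_var)

lemma pol_Der_eqI:
  assumes "D \<in> pol_Der" "E \<in> pol_Der" "\<And>i. D (var i) = E (var i)"
  shows "D = E"
  by (rule inj_onD[OF inj_on_der_ext _ assms(1,2)]) (simp add: der_ext_def assms(3))

lemma der_ext_var: "der_ext D (ser_var i) = ser_of_pol (D (var i))"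
  using ser_field_var[of "\<lambda>i. ser_of_pol (D (var i))"] by (simp add: ser_field_def der_ext_apply)

lemma der_ext_sum: "der_ext (sum x A) = (\<Sum>a\<in>A. der_ext (x a))"
  for x :: "'b \<Rightarrow> 'n::finite mpol \<Rightarrow> 'n mpol"
  by (simp add: fun_eq_iff der_ext_apply sum_fun_apply ser_of_pol_sum sum_distrib_right)
    (intro allI sum.swap)

lemma der_ext_zero: "der_ext 0 = 0"
  by (simp add: fun_eq_iff der_ext_apply ser_of_pol_simps)

lemma der_ext_diff: "der_ext (D - E) = der_ext D - der_ext E"
  by (simp add: fun_eq_iff der_ext_apply ser_of_pol_simps left_diff_distrib sum_subtractf)


section \<open>The filtration and the grading in terms of values on the variables\<close>

lemma ser_Der_filt_iff:
  "D \<in> ser_Der_filt k \<longleftrightarrow> D \<in> ser_Der \<and> (\<forall>i. ord_ge (k + 1) (D (ser_var i)))"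
proof -
  have deg: "enat (nat (k + 1)) \<le> ser_deg F \<longleftrightarrow> ord_ge (k + 1) F" for F :: "'a mser"
    by (simp add: ser_deg_ge_iff ord_ge_def nat_le_iff)
  have field: "(\<Sum>i\<in>UNIV. (\<lambda>F. f i * ser_pderiv i F)) = ser_field f" for f :: "'a \<Rightarrow> 'a mser"
    by (simp add: fun_eq_iff sum_fun_apply ser_field_def)
  show ?thesis
    unfolding ser_Der_filt_def deg field
    using ser_Der_eq_field[of D] by (auto simp: ser_field_in_ser_Der ser_field_var)
qed

text \<open>A polynomial derivation is the
  combination of the \<open>t\<^sup>\<alpha> \<partial>\<^sub>i\<close> whose coefficients are those of its values on the variables, so the
  span that defines a graded piece is described by coefficient conditions.\<close>

lemma pol_Der_grade_iff:
  fixes X :: "'n::finite mpol \<Rightarrow> 'n mpol"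
  shows "X \<in> pol_Der_grade k \<longleftrightarrow> X \<in> pol_Der \<and>
    (\<forall>i \<alpha>. Poly_Mapping.lookup (X (var i)) \<alpha> \<noteq> 0 \<longrightarrow> int (mdeg \<alpha>) = k + 1)"
proof -
  interpret op: vector_space "op_scale (pol_scale :: complex \<Rightarrow> 'n mpol \<Rightarrow> _)
      :: complex \<Rightarrow> ('n mpol \<Rightarrow> 'n mpol) \<Rightarrow> _"
    by (rule vector_space_op_scale) (rule vector_space_pol_scale)
  let ?B = "{(\<lambda>p :: 'n mpol. monom_pol \<alpha> * pol_pderiv i p) | \<alpha> i. int (mdeg \<alpha>) = k + 1}"
  define S where "S = {X :: 'n mpol \<Rightarrow> 'n mpol. X \<in> pol_Der \<and>
    (\<forall>i \<alpha>. Poly_Mapping.lookup (X (var i)) \<alpha> \<noteq> 0 \<longrightarrow> int (mdeg \<alpha>) = k + 1)}"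
  have gen: "(\<lambda>p :: 'n mpol. monom_pol \<alpha> * pol_pderiv i p)
      = pol_field (\<lambda>j. if j = i then monom_pol \<alpha> else 0)" for \<alpha> i
    by (simp add: fun_eq_iff pol_field_def if_distrib[of "\<lambda>x. x * _"] cong: if_cong)
  have lookup_monom: "Poly_Mapping.lookup (monom_pol \<alpha> :: 'n mpol) \<beta> = (if \<alpha> = \<beta> then 1 else 0)" for \<alpha> \<beta>
    by (simp add: monom_pol_def lookup_single when_def)
  have "?B \<subseteq> S"
    by (auto simp: S_def gen pol_field_in_pol_Der pol_field_var lookup_monom split: if_splits)
  moreover have "op.subspace S"
  proof (rule op.subspaceI)
    have lookup_scale: "Poly_Mapping.lookup (pol_scale c p) \<alpha> = c * Poly_Mapping.lookup p \<alpha>"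
      for c and p :: "'n mpol" and \<alpha>
      using arg_cong[OF ser_of_pol_scale[of c p], of "\<lambda>F. coeff F \<alpha>"] by (simp add: coeff_ser_scale)
    show "0 \<in> S" by (simp add: S_def pol_Der_closed)
    show "X + Y \<in> S" if "X \<in> S" "Y \<in> S" for X Y
      using that unfolding S_def by (auto simp: pol_Der_closed lookup_add) (metis add_0)
    show "op_scale pol_scale c X \<in> S" if "X \<in> S" for c X
      using that unfolding S_def by (auto simp: pol_Der_closed) (auto simp: op_scale_def lookup_scale)
  qed
  ultimately have sub: "pol_Der_grade k \<subseteq> S"
    unfolding pol_Der_grade_def by (rule op.span_minimal)
  have "X \<in> pol_Der_grade k" if X: "X \<in> S"
  proof -
    define c where "c i \<alpha> = Poly_Mapping.lookup (X (var i)) \<alpha>" for i \<alpha>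
    have val: "X (var i) = (\<Sum>\<alpha>\<in>Poly_Mapping.keys (X (var i)). pol_scale (c i \<alpha>) (monom_pol \<alpha>))" for i
      by (rule poly_mapping_eqI)
        (simp add: lookup_sum pol_scale_def monom_pol_def mult_single lookup_single when_def c_def
          not_in_keys_iff_lookup_eq_zero)
    have "X = pol_field (\<lambda>i. X (var i))"
      by (rule pol_Der_eqI) (use X in \<open>auto simp: S_def pol_field_in_pol_Der pol_field_var\<close>)
    also have "\<dots> = pol_field (\<lambda>i. \<Sum>\<alpha>\<in>Poly_Mapping.keys (X (var i)). pol_scale (c i \<alpha>) (monom_pol \<alpha>))"
      by (rule arg_cong[of _ _ pol_field], rule ext, rule val)
    also have "\<dots> = (\<Sum>i\<in>UNIV. \<Sum>\<alpha>\<in>Poly_Mapping.keys (X (var i)).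
        op_scale pol_scale (c i \<alpha>) (\<lambda>p. monom_pol \<alpha> * pol_pderiv i p))"
      by (simp add: fun_eq_iff pol_field_def sum_fun_apply op_scale_def pol_scale_mult sum_distrib_right)
    also have "\<dots> \<in> op.span ?B"
      using X by (intro op.span_sum op.span_scale op.span_base)
        (auto simp: S_def in_keys_iff)
    finally show ?thesis by (simp add: pol_Der_grade_def)
  qed
  then show ?thesis using sub by (auto simp: S_def)
qed

lemma ser_Der_filt_mono: "D \<in> ser_Der_filt j \<Longrightarrow> k \<le> j \<Longrightarrow> D \<in> ser_Der_filt k"
  unfolding ser_Der_filt_iff ord_ge_def by force

lemma ser_Der_filt_add: "D \<in> ser_Der_filt k \<Longrightarrow> E \<in> ser_Der_filt k \<Longrightarrow> D + E \<in> ser_Der_filt k"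
  unfolding ser_Der_filt_iff by (simp add: ser_Der_closed ord_ge_add)

lemma ser_Der_filt_diff: "D \<in> ser_Der_filt k \<Longrightarrow> E \<in> ser_Der_filt k \<Longrightarrow> D - E \<in> ser_Der_filt k"
  unfolding ser_Der_filt_iff by (simp add: ser_Der_closed ord_ge_diff)

lemma ser_Der_filt_scale:
  assumes "D \<in> ser_Der_filt k"
  shows "op_scale ser_scale c D \<in> ser_Der_filt k"
proof -
  have "ord_ge (k + 1) (op_scale ser_scale c D (ser_var i))" for i
    using assms by (auto simp: ser_Der_filt_iff ord_ge_def op_scale_def coeff_ser_scale)
  then show ?thesis
    using assms by (simp add: ser_Der_filt_iff ser_Der_closed)
qed

lemma ser_Der_filt_minus_1: "D \<in> ser_Der \<Longrightarrow> D \<in> ser_Der_filt (- 1)"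
  by (simp add: ser_Der_filt_iff ord_ge_def)

lemma der_ext_grade: "X \<in> pol_Der_grade k \<Longrightarrow> der_ext X \<in> ser_Der_filt k"
  by (auto simp: ser_Der_filt_iff pol_Der_grade_iff ord_ge_def der_ext_in_ser_Der der_ext_var)

lemma ord_ge_filt:
  assumes "D \<in> ser_Der_filt k" "ord_ge d F"
  shows "ord_ge (k + d) (D F)"
proof -
  have "D F = (\<Sum>i\<in>UNIV. D (ser_var i) * ser_pderiv i F)"
    using assms(1) ser_Der_eq_field[of D] by (metis ser_Der_filt_iff ser_field_def)
  moreover have "ord_ge ((k + 1) + (d - 1)) (D (ser_var i) * ser_pderiv i F)" for i
    using assms by (intro ord_ge_mult ord_ge_pderiv) (simp_all add: ser_Der_filt_iff)
  ultimately show ?thesis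
    by (simp add: ord_ge_sum)
qed

lemma lie_bracket_filt:
  assumes D: "D \<in> ser_Der_filt j" and E: "E \<in> ser_Der_filt k"
  shows "lie_bracket D E \<in> ser_Der_filt (j + k)"
proof -
  have "ord_ge (j + (k + 1)) (D (E (ser_var i)))" for i
    using E by (intro ord_ge_filt[OF D]) (simp add: ser_Der_filt_iff)
  moreover have "ord_ge (k + (j + 1)) (E (D (ser_var i)))" for i
    using D by (intro ord_ge_filt[OF E]) (simp add: ser_Der_filt_iff)
  ultimately have "ord_ge (j + k + 1) (lie_bracket D E (ser_var i))" for i
    unfolding lie_bracket_def by (intro ord_ge_diff) (simp_all add: ac_simps)
  moreover have "lie_bracket D E \<in> ser_Der"
    using D E by (intro ser_Der_closed) (auto simp: ser_Der_filt_iff)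
  ultimately show ?thesis
    by (simp add: ser_Der_filt_iff)
qed


section \<open>Homogeneous components\<close>

lift_definition hom_part :: "int \<Rightarrow> 'n::finite mser \<Rightarrow> 'n mpol"
  is "\<lambda>d F \<alpha>. if int (mdeg \<alpha>) = d then F \<alpha> else 0"
proof -
  fix d and F :: "'n mexp \<Rightarrow> complex"
  have "{\<alpha>. (if int (mdeg \<alpha>) = d then F \<alpha> else 0) \<noteq> 0}
      \<subseteq> {\<alpha>. \<forall>i. Poly_Mapping.lookup \<alpha> i \<le> nat d}"
    using lookup_le_mdeg by (auto split: if_splits)
  then show "finite {\<alpha>. (if int (mdeg \<alpha>) = d then F \<alpha> else 0) \<noteq> 0}"
    by (rule finite_subset) (rule finite_le_exp)
qed

definition grade_comp :: "('n::finite mser \<Rightarrow> 'n mser) \<Rightarrow> int \<Rightarrow> 'n mpol \<Rightarrow> 'n mpol"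
  where "grade_comp D k = pol_field (\<lambda>i. hom_part (k + 1) (D (ser_var i)))"

definition trunc_field :: "('n::finite mser \<Rightarrow> 'n mser) \<Rightarrow> int \<Rightarrow> 'n mpol \<Rightarrow> 'n mpol"
  where "trunc_field D k = (\<Sum>i\<in>{-1..k}. grade_comp D i)"

lemma lookup_grade_comp: "Poly_Mapping.lookup (grade_comp D k (var i)) \<alpha>
    = (if int (mdeg \<alpha>) = k + 1 then coeff (D (ser_var i)) \<alpha> else 0)"
  by (simp add: grade_comp_def pol_field_var hom_part.rep_eq)

lemma grade_comp_in_pol_Der: "grade_comp D k \<in> pol_Der"
  by (simp add: grade_comp_def pol_field_in_pol_Der)

lemma grade_comp_in_grade: "grade_comp D k \<in> pol_Der_grade k"
  by (simp add: pol_Der_grade_iff grade_comp_in_pol_Der lookup_grade_comp)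

lemma trunc_field_in_pol_Der: "trunc_field D k \<in> pol_Der"
  unfolding trunc_field_def by (intro pol_Der_closed grade_comp_in_pol_Der)

lemma lookup_trunc_field: "Poly_Mapping.lookup (trunc_field D k (var i)) \<alpha>
    = (if int (mdeg \<alpha>) \<le> k + 1 then coeff (D (ser_var i)) \<alpha> else 0)"
proof -
  have "Poly_Mapping.lookup (trunc_field D k (var i)) \<alpha>
      = (\<Sum>j\<in>{-1..k}. if j = int (mdeg \<alpha>) - 1 then coeff (D (ser_var i)) \<alpha> else 0)"
    unfolding trunc_field_def sum_fun_apply lookup_sum lookup_grade_comp
    by (rule sum.cong) auto
  then show ?thesis by simp
qed

lemma trunc_field_remainder:
  assumes "D \<in> ser_Der" "j \<le> k + 1"
  shows "D - der_ext (trunc_field D k) \<in> ser_Der_filt j"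
  using assms
  by (auto simp: ser_Der_filt_iff ser_Der_closed der_ext_in_ser_Der ord_ge_def der_ext_var
      lookup_trunc_field split: if_splits)

lemma pol_Der_eventually_trunc:
  assumes "P \<in> pol_Der"
  obtains K :: nat where "trunc_field (der_ext P) (int K) = P"
proof -
  have "finite (\<Union>i. mdeg ` Poly_Mapping.keys (P (var i)))" by simp
  then obtain K where K: "\<forall>d\<in>(\<Union>i. mdeg ` Poly_Mapping.keys (P (var i))). d \<le> K"
    using finite_nat_set_iff_bounded_le by metis
  have "trunc_field (der_ext P) (int K) = P"
  proof (rule pol_Der_eqI[OF trunc_field_in_pol_Der assms], rule poly_mapping_eqI)
    fix i \<alpha>
    have "Poly_Mapping.lookup (P (var i)) \<alpha> = 0" if "K < mdeg \<alpha>"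
      using K that by (force simp: in_keys_iff)
    then show "Poly_Mapping.lookup (trunc_field (der_ext P) (int K) (var i)) \<alpha>
        = Poly_Mapping.lookup (P (var i)) \<alpha>"
      by (auto simp: lookup_trunc_field der_ext_var)
  qed
  then show thesis by (rule that)
qed

text \<open>On the variables, only the component of index \<open>d - 1\<close> has values with a nonzero part of degree
  \<open>d\<close>. That part of the partial sums is therefore constant from this index on, and convergence
  forces it to be the part of degree \<open>d\<close> of the values of \<open>D\<close>.\<close>

lemma homogeneous_expansion_iff:
  assumes D: "D \<in> ser_Der"
  shows "homogeneous_expansion D x \<longleftrightarrow> x = grade_comp D"
proof
  assume "x = grade_comp D"
  moreover have "D - (\<Sum>i\<in>{-1..int k}. der_ext (grade_comp D i)) \<in> ser_Der_filt (int m)" if "k \<ge> m" for k m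
    using trunc_field_remainder[OF D, of "int m" "int k"] that by (simp add: trunc_field_def der_ext_sum)
  ultimately show "homogeneous_expansion D x"
    unfolding homogeneous_expansion_def by (blast intro: grade_comp_in_grade)
next
  assume x: "homogeneous_expansion D x"
  then have grade: "x i \<in> pol_Der_grade i" for i
    by (simp add: homogeneous_expansion_def)
  show "x = grade_comp D"
  proof (rule ext, rule pol_Der_eqI, goal_cases)
    case (3 l i)
    show ?case
    proof (rule poly_mapping_eqI)
      fix \<alpha>
      show "Poly_Mapping.lookup (x l (var i)) \<alpha> = Poly_Mapping.lookup (grade_comp D l (var i)) \<alpha>"
      proof (cases "int (mdeg \<alpha>) = l + 1")
        case False
        then show ?thesis
          using grade[of l] by (auto simp: lookup_grade_comp pol_Der_grade_iff)
      next
        case True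
        obtain K :: nat where K: "\<And>k. k \<ge> K \<Longrightarrow>
            D - (\<Sum>i\<in>{-1..int k}. der_ext (x i)) \<in> ser_Der_filt (int (mdeg \<alpha>))"
          using x unfolding homogeneous_expansion_def by blast
        have off: "Poly_Mapping.lookup (x j (var i)) \<alpha> = 0" if "j \<noteq> l" for j
          using grade[of j] True that unfolding pol_Der_grade_iff by (metis add_right_cancel)
        define k where "k = max K (mdeg \<alpha>)"
        have "mdeg \<alpha> \<le> k" by (simp add: k_def)
        then have "l \<in> {-1..int k}" using True by auto
        have "coeff ((D - (\<Sum>i\<in>{-1..int k}. der_ext (x i))) (ser_var i)) \<alpha> = 0"
          using K[of k] by (intro ord_geD[of "int (mdeg \<alpha>) + 1"]) (auto simp: ser_Der_filt_iff k_def)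
        then have "coeff (D (ser_var i)) \<alpha> = (\<Sum>j\<in>{-1..int k}. Poly_Mapping.lookup (x j (var i)) \<alpha>)"
          by (simp add: sum_fun_apply der_ext_var coeff_sum)
        also have "\<dots> = (\<Sum>j\<in>{-1..int k}. if j = l then Poly_Mapping.lookup (x l (var i)) \<alpha> else 0)"
          using off by (intro sum.cong) auto
        also have "\<dots> = Poly_Mapping.lookup (x l (var i)) \<alpha>"
          using \<open>l \<in> {-1..int k}\<close> by simp
        finally show ?thesis
          using True by (simp add: lookup_grade_comp)
      qed
    qed
  qed (use grade in \<open>simp_all add: pol_Der_grade_iff grade_comp_in_pol_Der\<close>)
qed


section \<open>Restriction from formal to polynomial vector fields\<close>

context lie_module
begin

lemma act_zero: "act 0 v = 0"
  using act_add[OF zero_mem zero_mem, of v] by simp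

lemma act_sum: "(\<And>a. a \<in> A \<Longrightarrow> x a \<in> G) \<Longrightarrow> act (sum x A) v = (\<Sum>a\<in>A. act (x a) v)"
proof (induction A rule: infinite_finite_induct)
  case (insert a A)
  then show ?case
    by (subst (1 2) sum.insert) (auto simp del: plus_fun_apply simp: act_add sum_mem)
qed (simp_all add: act_zero)

lemma act_diff: "D \<in> G \<Longrightarrow> E \<in> G \<Longrightarrow> act (D - E) v = act D v - act E v"
  using act_add[OF diff_mem[of D E], of E v] by (simp add: algebra_simps)

end

lemma lie_module_restrict:
  assumes "lie_module ser_scale ser_Der sV (act :: ('n::finite mser \<Rightarrow> 'n mser) \<Rightarrow> 'v::ab_group_add \<Rightarrow> 'v)"
  shows "lie_module pol_scale pol_Der sV (\<lambda>D. act (der_ext D))"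
proof -
  interpret lie_module ser_scale ser_Der sV act by fact
  show ?thesis
    by (intro lie_module.intro lie_module_axioms.intro operator_lie_algebra_pol_Der V.vector_space_axioms)
      (simp_all add: der_ext_in_ser_Der act_linear der_ext_add act_add der_ext_scale act_scale
        der_ext_bracket act_bracket)
qed

text \<open>A vector is killed by some level of the filtration, so on that vector a formal vector field
  acts as one of its truncations. Hence a subspace stable under polynomial vector fields is stable
  under formal ones, and simplicity descends.\<close>

lemma simple_smooth_restrict:
  fixes act :: "('n::finite mser \<Rightarrow> 'n mser) \<Rightarrow> 'v::ab_group_add \<Rightarrow> 'v"
  assumes simple: "simple_lie_module ser_scale ser_Der sV act" and cont: "continuous_action act"
  shows "simple_lie_module pol_scale pol_Der sV (\<lambda>D. act (der_ext D))"
    and "smooth_action (\<lambda>D. act (der_ext D))"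
proof -
  interpret simple_lie_module ser_scale ser_Der sV act by (rule simple)
  show "smooth_action (\<lambda>D. act (der_ext D))"
    using cont unfolding smooth_action_def continuous_action_def
    by (meson der_ext_grade ser_Der_filt_mono)
  show "simple_lie_module pol_scale pol_Der sV (\<lambda>D. act (der_ext D))"
  proof (intro simple_lie_module.intro simple_lie_module_axioms.intro lie_module_restrict
      lie_module_axioms nonzero)
    fix W
    assume W: "V.subspace W" and inv: "\<forall>D\<in>pol_Der. \<forall>w\<in>W. act (der_ext D) w \<in> W"
    have "act D w \<in> W" if D: "D \<in> ser_Der" and w: "w \<in> W" for D w
    proof -
      obtain k :: nat where k: "\<And>E. E \<in> ser_Der_filt (int k) \<Longrightarrow> act E w = 0"
        using cont unfolding continuous_action_def by blast
      let ?P = "trunc_field D (int k)"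
      have "act (D - der_ext ?P) w = 0"
        by (rule k) (simp add: trunc_field_remainder D)
      then have "act D w = act (der_ext ?P) w"
        by (simp add: act_diff D der_ext_in_ser_Der)
      then show ?thesis
        using inv w trunc_field_in_pol_Der by auto
    qed
    then show "W = {0} \<or> W = UNIV"
      using no_proper_submodule[OF W] by blast
  qed
qed


section \<open>Extension from polynomial to formal vector fields\<close>

locale smooth_lie_module = lie_module pol_scale pol_Der sV act
  for sV :: "complex \<Rightarrow> 'v::ab_group_add \<Rightarrow> 'v"
    and act :: "('n::finite mpol \<Rightarrow> 'n mpol) \<Rightarrow> 'v \<Rightarrow> 'v" +
  assumes smooth: "smooth_action act"
begin

definition killed_from :: "nat \<Rightarrow> 'v \<Rightarrow> bool"
  where "killed_from m v \<longleftrightarrow> (\<forall>i\<ge>int m. \<forall>X\<in>pol_Der_grade i. act X v = 0)"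

text \<open>The index set is finite by smoothness, so the default value of infinite sums never occurs.\<close>

definition completion :: "('n mser \<Rightarrow> 'n mser) \<Rightarrow> 'v \<Rightarrow> 'v"
  where "completion D v = (\<Sum>i | i \<ge> -1 \<and> act (grade_comp D i) v \<noteq> 0. act (grade_comp D i) v)"

lemma killed_from_mono: "killed_from m v \<Longrightarrow> m \<le> m' \<Longrightarrow> killed_from m' v"
  unfolding killed_from_def by (meson of_nat_mono order_trans)

lemma killed_from_ex: "\<exists>m. killed_from m v"
  using smooth by (simp add: smooth_action_def killed_from_def)

lemma killed_from_common:
  obtains m where "killed_from m u" "killed_from m v" "killed_from m w"
proof -
  obtain a b c where "killed_from a u" "killed_from b v" "killed_from c w"
    using killed_from_ex by metis
  then show thesis
    by (intro that[of "max a (max b c)"]) (auto elim: killed_from_mono)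
qed

text \<open>Smoothness speaks of homogeneous fields, whereas the difference of two approximations of a formal
  field is only of high order. Being polynomial, the difference is a finite sum of homogeneous
  components, and those of low degree vanish.\<close>

lemma act_high_order_eq_0:
  assumes v: "killed_from m v" and P: "P \<in> pol_Der" "der_ext P \<in> ser_Der_filt (int m)"
  shows "act P v = 0"
proof -
  obtain K :: nat where K: "trunc_field (der_ext P) (int K) = P"
    using P(1) by (rule pol_Der_eventually_trunc)
  have "act (grade_comp (der_ext P) i) v = 0" for i
  proof (cases "i \<ge> int m")
    case True
    then show ?thesis using v grade_comp_in_grade unfolding killed_from_def by blast
  next
    case False
    have "grade_comp (der_ext P) i = 0"
    proof (rule pol_Der_eqI[OF grade_comp_in_pol_Der pol_Der_closed(1)], rule poly_mapping_eqI)
      fix j \<alpha>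
      show "Poly_Mapping.lookup (grade_comp (der_ext P) i (var j)) \<alpha> = Poly_Mapping.lookup (0 (var j)) \<alpha>"
        using P(2) False by (auto simp: lookup_grade_comp ser_Der_filt_iff intro: ord_geD)
    qed
    then show ?thesis by (simp add: act_zero)
  qed
  then have "act (trunc_field (der_ext P) (int K)) v = 0"
    unfolding trunc_field_def by (subst act_sum) (simp_all add: grade_comp_in_pol_Der)
  then show ?thesis by (simp add: K)
qed

lemma support_bounded:
  assumes "killed_from m v"
  shows "{i. i \<ge> -1 \<and> act (grade_comp D i) v \<noteq> 0} \<subseteq> {-1..int m}"
proof (clarsimp, rule ccontr)
  fix i
  assume "act (grade_comp D i) v \<noteq> 0" "\<not> i \<le> int m"
  moreover from this have "int m \<le> i" by simp
  ultimately show False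
    using assms grade_comp_in_grade[of D i] unfolding killed_from_def by blast
qed

text \<open>The action of \<open>D\<close> on \<open>v\<close> can be computed from any polynomial vector field close enough to \<open>D\<close>.
  This reduces every identity for the extended action to the same identity for polynomial vector
  fields.\<close>

lemma completion_eq_act:
  assumes v: "killed_from m v" and D: "D \<in> ser_Der" and P: "P \<in> pol_Der"
    and approx: "D - der_ext P \<in> ser_Der_filt (int m)"
  shows "completion D v = act P v"
proof -
  let ?T = "trunc_field D (int m)"
  have "completion D v = (\<Sum>i\<in>{-1..int m}. act (grade_comp D i) v)"
    unfolding completion_def
    by (rule sum.mono_neutral_left) (use support_bounded[OF v] in auto)
  also have "\<dots> = act ?T v"
    unfolding trunc_field_def by (subst act_sum) (simp_all add: grade_comp_in_pol_Der)
  also have "\<dots> = act P v"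
  proof -
    have "der_ext (P - ?T) \<in> ser_Der_filt (int m)"
      using ser_Der_filt_diff[OF trunc_field_remainder[OF D, of "int m" "int m"] approx]
      by (simp add: der_ext_diff)
    then have "act (P - ?T) v = 0"
      using v P by (intro act_high_order_eq_0) (simp_all add: pol_Der_closed trunc_field_in_pol_Der)
    then show ?thesis
      by (simp add: act_diff P trunc_field_in_pol_Der)
  qed
  finally show ?thesis .
qed

lemma completion_eq_trunc:
  assumes "killed_from m v" "D \<in> ser_Der"
  shows "completion D v = act (trunc_field D (int m)) v"
  by (rule completion_eq_act[OF assms trunc_field_in_pol_Der trunc_field_remainder[OF assms(2)]]) simp

lemma completion_der_ext: "P \<in> pol_Der \<Longrightarrow> completion (der_ext P) v = act P v"
proof -
  obtain m where m: "killed_from m v" using killed_from_ex by blast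
  have "(0 :: 'n mser \<Rightarrow> 'n mser) \<in> ser_Der_filt (int m)"
    by (simp add: ser_Der_filt_iff ser_Der_closed ord_ge_0)
  then show "P \<in> pol_Der \<Longrightarrow> completion (der_ext P) v = act P v"
    by (intro completion_eq_act[OF m]) (simp_all add: der_ext_in_ser_Der)
qed

lemma completion_linear:
  assumes D: "D \<in> ser_Der"
  shows "Vector_Spaces.linear sV sV (completion D)"
  unfolding Vector_Spaces.linear_iff
proof (intro conjI allI V.vector_space_axioms)
  fix v w c
  obtain m where m: "killed_from m v" "killed_from m w" "killed_from m (v + w)"
    by (rule killed_from_common)
  obtain k where k: "killed_from k v" "killed_from k (sV c v)"
    by (rule killed_from_common)
  have lin: "act P (x + y) = act P x + act P y" "act P (sV c x) = sV c (act P x)"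
    if "P \<in> pol_Der" for P x y
    using act_linear[OF that] unfolding Vector_Spaces.linear_iff by blast+
  show "completion D (v + w) = completion D v + completion D w"
    by (simp add: completion_eq_trunc[OF m(1) D] completion_eq_trunc[OF m(2) D]
        completion_eq_trunc[OF m(3) D] lin trunc_field_in_pol_Der)
  show "completion D (sV c v) = sV c (completion D v)"
    by (simp add: completion_eq_trunc[OF k(1) D] completion_eq_trunc[OF k(2) D] lin
        trunc_field_in_pol_Der)
qed

lemma completion_add:
  assumes D: "D \<in> ser_Der" and E: "E \<in> ser_Der"
  shows "completion (D + E) v = completion D v + completion E v"
proof -
  obtain m where m: "killed_from m v" using killed_from_ex by blast
  let ?P = "trunc_field D (int m)" and ?Q = "trunc_field E (int m)"
  have "(D + E) - der_ext (?P + ?Q) = (D - der_ext ?P) + (E - der_ext ?Q)"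
    by (simp add: der_ext_add)
  also have "\<dots> \<in> ser_Der_filt (int m)"
    by (intro ser_Der_filt_add trunc_field_remainder D E) simp_all
  finally have "completion (D + E) v = act (?P + ?Q) v"
    by (intro completion_eq_act[OF m] ser_Der_closed pol_Der_closed trunc_field_in_pol_Der D E)
  then show ?thesis
    by (simp add: act_add trunc_field_in_pol_Der completion_eq_trunc[OF m] D E)
qed

lemma completion_scale:
  assumes D: "D \<in> ser_Der"
  shows "completion (op_scale ser_scale c D) v = sV c (completion D v)"
proof -
  obtain m where m: "killed_from m v" using killed_from_ex by blast
  let ?P = "trunc_field D (int m)"
  have "op_scale ser_scale c D - der_ext (op_scale pol_scale c ?P)
      = op_scale ser_scale c (D - der_ext ?P)"
    unfolding der_ext_scale
    by (intro ext mser_eqI) (simp add: op_scale_def coeff_ser_scale right_diff_distrib)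
  also have "op_scale ser_scale c (D - der_ext ?P) \<in> ser_Der_filt (int m)"
    by (intro ser_Der_filt_scale trunc_field_remainder D) simp
  finally have "completion (op_scale ser_scale c D) v = act (op_scale pol_scale c ?P) v"
    by (intro completion_eq_act[OF m] ser_Der_closed pol_Der_closed trunc_field_in_pol_Der D)
  then show ?thesis
    by (simp add: act_scale trunc_field_in_pol_Der completion_eq_trunc[OF m] D)
qed

text \<open>Bracketing with a vector field of level \<open>-1\<close> costs one degree of precision, so truncations one
  step finer than what kills the vectors involved are needed.\<close>

lemma completion_bracket:
  assumes D: "D \<in> ser_Der" and E: "E \<in> ser_Der"
  shows "completion (lie_bracket D E) v = completion D (completion E v) - completion E (completion D v)"
proof -
  obtain m where m: "killed_from m v" "killed_from m (completion E v)" "killed_from m (completion D v)"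
    by (rule killed_from_common)
  define P where "P = trunc_field D (int (Suc m))"
  define Q where "Q = trunc_field E (int (Suc m))"
  have P: "P \<in> pol_Der" and Q: "Q \<in> pol_Der"
    by (simp_all add: P_def Q_def trunc_field_in_pol_Der)
  have PD: "D - der_ext P \<in> ser_Der_filt (int (Suc m))" and QE: "E - der_ext Q \<in> ser_Der_filt (int (Suc m))"
    by (simp_all add: P_def Q_def trunc_field_remainder D E)
  have act_eq: "completion D w = act P w" "completion E w = act Q w" if "killed_from m w" for w
    using PD QE by (auto intro!: completion_eq_act[OF that] D E P Q elim: ser_Der_filt_mono)
  have "lie_bracket D E - der_ext (lie_bracket P Q)
      = lie_bracket (D - der_ext P) E + lie_bracket (der_ext P) (E - der_ext Q)"
  proof -
    have diff: "X (F - G) = X F - X G" if "X \<in> ser_Der" for X :: "'n mser \<Rightarrow> 'n mser" and F G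
    proof -
      have "X ((F - G) + G) = X (F - G) + X G"
        using that unfolding ser_Der_iff by blast
      then show ?thesis by (simp add: algebra_simps)
    qed
    show ?thesis
      unfolding der_ext_bracket[OF P Q]
      by (simp add: fun_eq_iff lie_bracket_def diff D E der_ext_in_ser_Der)
  qed
  moreover have "lie_bracket (D - der_ext P) E \<in> ser_Der_filt (int m)"
    using lie_bracket_filt[OF PD ser_Der_filt_minus_1[OF E]] by simp
  moreover have "lie_bracket (der_ext P) (E - der_ext Q) \<in> ser_Der_filt (int m)"
    using lie_bracket_filt[OF ser_Der_filt_minus_1[OF der_ext_in_ser_Der] QE] by simp
  ultimately have "lie_bracket D E - der_ext (lie_bracket P Q) \<in> ser_Der_filt (int m)"
    by (simp only: ser_Der_filt_add)
  then have "completion (lie_bracket D E) v = act (lie_bracket P Q) v"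
    by (intro completion_eq_act[OF m(1)] ser_Der_closed pol_Der_closed D E P Q)
  also have "\<dots> = act P (completion E v) - act Q (completion D v)"
    by (simp add: act_bracket P Q act_eq[OF m(1)])
  also have "\<dots> = completion D (completion E v) - completion E (completion D v)"
    by (simp only: act_eq(1)[OF m(2)] act_eq(2)[OF m(3)])
  finally show ?thesis .
qed

lemma lie_module_completion: "lie_module ser_scale ser_Der sV completion"
  by (intro lie_module.intro lie_module_axioms.intro operator_lie_algebra_ser_Der
      V.vector_space_axioms completion_linear completion_add completion_scale completion_bracket)

lemma continuous_completion: "continuous_action completion"
  unfolding continuous_action_def
proof
  fix v
  obtain m where m: "killed_from m v" using killed_from_ex by blast
  have "completion D v = 0" if "D \<in> ser_Der_filt (int (Suc m))" for D
  proof -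
    have "D - der_ext 0 \<in> ser_Der_filt (int m)"
      using ser_Der_filt_mono[OF that, of "int m"] by (simp add: der_ext_zero)
    moreover have "D \<in> ser_Der"
      using that by (simp add: ser_Der_filt_iff)
    ultimately have "completion D v = act 0 v"
      by (intro completion_eq_act[OF m] pol_Der_closed)
    then show ?thesis by (simp add: act_zero)
  qed
  then show "\<exists>k::nat. k > 0 \<and> (\<forall>D\<in>ser_Der_filt (int k). completion D v = 0)"
    by blast
qed

lemma simple_completion:
  assumes "simple_lie_module pol_scale pol_Der sV act"
  shows "simple_lie_module ser_scale ser_Der sV completion"
proof (intro simple_lie_module.intro simple_lie_module_axioms.intro lie_module_completion)
  interpret S: simple_lie_module pol_scale pol_Der sV act by fact
  show "\<exists>v::'v. v \<noteq> 0" by (rule S.nonzero)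
  fix W
  assume W: "V.subspace W" and inv: "\<forall>D\<in>ser_Der. \<forall>w\<in>W. completion D w \<in> W"
  have "act P w \<in> W" if P: "P \<in> pol_Der" and w: "w \<in> W" for P w
    using inv[rule_format, OF der_ext_in_ser_Der w, of P] by (simp only: completion_der_ext[OF P])
  then show "W = {0} \<or> W = UNIV"
    by (intro S.no_proper_submodule W) blast
qed

end


theorem theorem2p3:
  fixes scaleV :: "complex \<Rightarrow> 'v::ab_group_add \<Rightarrow> 'v"
  shows
    "(\<forall>act :: ('n::finite mser \<Rightarrow> 'n mser) \<Rightarrow> 'v \<Rightarrow> 'v.
        simple_lie_module ser_scale ser_Der scaleV act \<and> continuous_action act \<longrightarrow>
        simple_lie_module pol_scale pol_Der scaleV (\<lambda>D. act (der_ext D)) \<and>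
        smooth_action (\<lambda>D. act (der_ext D)))
     \<and>
     (\<forall>D \<in> (ser_Der :: ('n mser \<Rightarrow> 'n mser) set). \<exists>!x. homogeneous_expansion D x)
     \<and>
     (\<forall>act :: ('n mpol \<Rightarrow> 'n mpol) \<Rightarrow> 'v \<Rightarrow> 'v.
        simple_lie_module pol_scale pol_Der scaleV act \<and> smooth_action act \<longrightarrow>
        (\<exists>actL :: ('n mser \<Rightarrow> 'n mser) \<Rightarrow> 'v \<Rightarrow> 'v.
           (\<forall>D\<in>ser_Der. \<forall>x. homogeneous_expansion D x \<longrightarrow>
              (\<forall>v. finite {i. i \<ge> -1 \<and> act (x i) v \<noteq> 0} \<and>
                   actL D v = (\<Sum>i | i \<ge> -1 \<and> act (x i) v \<noteq> 0. act (x i) v))) \<and>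
           simple_lie_module ser_scale ser_Der scaleV actL \<and>
           continuous_action actL))"
proof (intro conjI allI ballI impI, goal_cases)
  case (1 act)
  then show ?case by (elim conjE) (rule simple_smooth_restrict)
next
  case (2 act)
  then show ?case by (elim conjE) (rule simple_smooth_restrict)
next
  case (3 D)
  then show ?case by (simp add: homogeneous_expansion_iff)
next
  case (4 act)
  then interpret simple_lie_module pol_scale pol_Der scaleV act by blast
  interpret smooth_lie_module scaleV act
    using 4 by unfold_locales blast
  have "finite {i. i \<ge> -1 \<and> act (grade_comp D i) v \<noteq> 0}" for D v
  proof -
    obtain m where "killed_from m v" using killed_from_ex by blast
    then show ?thesis by (rule finite_subset[OF support_bounded]) simp
  qed
  then have "\<forall>D\<in>ser_Der. \<forall>x. homogeneous_expansion D x \<longrightarrow>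
      (\<forall>v. finite {i. i \<ge> -1 \<and> act (x i) v \<noteq> 0} \<and>
        completion D v = (\<Sum>i | i \<ge> -1 \<and> act (x i) v \<noteq> 0. act (x i) v))"
    by (intro ballI allI impI conjI) (simp_all only: homogeneous_expansion_iff completion_def)
  moreover have "simple_lie_module ser_scale ser_Der scaleV completion"
    by (rule simple_completion) (rule simple_lie_module_axioms)
  ultimately show ?case
    using continuous_completion by blast
qed

end
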